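(* Let $k$ be an algebraically closed field of characteristic zero and let $q\in k^*$ be not a root of unity. Let $f_1,f_2\in k[h]$ with $f_1(0)=f_2(0)=0$, and for $i=1,2$ let $a_i\in k[h]$ be a polynomial such that $f_i(h)=a_i(qh)-a_i(h)$. Then there is an isomorphism of $k$-algebras between the Smith algebras $R(f_1)$ and $R(f_2)$ if and only if there exist $\alpha\in k$ and $\beta,\rho\in k^*$ such that $a_1(h)=\rho\, a_2(\beta h)+\alpha$.
   Context: For $q\in k^*$ not a root of unity and $f\in k[h]$ with $f(0)=0$, the (quantum) Smith algebra $R(f)$ is the unital associative $k$-algebra generated by $x,y,h$ subject to the relations $xh=qhx$, $hy=q\,yh$, $xy-yx=f(h)$ (that is, $xh=\sigma(h)x$ and $hy=y\sigma(h)$ with $\sigma(h)=qh$). The hypothesis $f(0)=0$ ensures that there exists $a\in k[h]$ with $f(h)=a(qh)-a(h)$; it is determined by $f$ up to its constant term. *)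

theory Defs
  imports
    "HOL-Algebra.QuotRing"
    "HOL-Algebra.Module"
    "HOL-Library.Poly_Mapping"
    "HOL-Computational_Algebra.Polynomial"
begin

text \<open>
  The free algebra on an alphabet is the monoid algebra of the free monoid of words:
  multiplication of finitely supported functions is convolution with respect to addition on
  the index type, so the monoid of words is written additively.
\<close>

datatype 'g word = Word (letters: "'g list")

instantiation word :: (type) monoid_add
begin

definition zero_word :: "'a word"
  where "0 = Word []"

definition plus_word :: "'a word \<Rightarrow> 'a word \<Rightarrow> 'a word"
  where "u + v = Word (letters u @ letters v)"

instance
  by standard (simp_all add: zero_word_def plus_word_def)

end

text \<open>
  An algebra over a field type is represented by the library's \<open>module\<close> record, whose
  scalars are all elements of that type.
\<close>

definition free_algebra :: "('k::field, 'g word \<Rightarrow>\<^sub>0 'k) module"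
  where "free_algebra =
    \<lparr>carrier = UNIV, monoid.mult = (*), one = 1, zero = 0, add = (+),
     module.smult = (\<lambda>c p. Poly_Mapping.single 0 c * p)\<rparr>"

definition free_gen :: "'g \<Rightarrow> ('g word \<Rightarrow>\<^sub>0 'k::field)"
  where "free_gen g = Poly_Mapping.single (Word [g]) 1"

text \<open>Evaluation of a polynomial at an element of the (noncommutative) free algebra.\<close>

definition free_eval :: "'k::field poly \<Rightarrow> ('g word \<Rightarrow>\<^sub>0 'k) \<Rightarrow> ('g word \<Rightarrow>\<^sub>0 'k)"
  where "free_eval f p = (\<Sum>i\<le>degree f. Poly_Mapping.single 0 (coeff f i) * p ^ i)"

definition quotient_algebra ::
    "('k, 'a, 'b) module_scheme \<Rightarrow> 'a set \<Rightarrow> ('k, 'a set) module"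
  where "quotient_algebra A I = ring.extend (A Quot I)
    \<lparr>module.smult = (\<lambda>c X. (I +>\<^bsub>A\<^esub> (c \<odot>\<^bsub>A\<^esub> \<one>\<^bsub>A\<^esub>)) \<otimes>\<^bsub>A Quot I\<^esub> X)\<rparr>"

definition algebra_iso ::
    "('k, 'a, 'c) module_scheme \<Rightarrow> ('k, 'b, 'd) module_scheme \<Rightarrow> ('a \<Rightarrow> 'b) set"
  where "algebra_iso A B =
    {\<phi> \<in> ring_iso A B. \<forall>c. \<forall>a\<in>carrier A. \<phi> (c \<odot>\<^bsub>A\<^esub> a) = c \<odot>\<^bsub>B\<^esub> \<phi> a}"

datatype smith_gen = X | Y | H

definition smith_relators :: "'k::field \<Rightarrow> 'k poly \<Rightarrow> (smith_gen word \<Rightarrow>\<^sub>0 'k) set"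
  where "smith_relators q f =
    (let x = free_gen X; y = free_gen Y; h = free_gen H; scal = Poly_Mapping.single 0
     in {x * h - scal q * h * x, h * y - scal q * y * h, x * y - y * x - free_eval f h})"

definition smith_ideal :: "'k::field \<Rightarrow> 'k poly \<Rightarrow> (smith_gen word \<Rightarrow>\<^sub>0 'k) set"
  where "smith_ideal q f = genideal free_algebra (smith_relators q f)"

definition smith_algebra :: "'k::field \<Rightarrow> 'k poly \<Rightarrow> ('k, (smith_gen word \<Rightarrow>\<^sub>0 'k) set) module"
  where "smith_algebra q f = quotient_algebra free_algebra (smith_ideal q f)"

lemma ring_free_algebra: "ring (free_algebra :: ('k::field, 'g word \<Rightarrow>\<^sub>0 'k) module)"
proof (rule ringI)
  show "abelian_group (free_algebra :: ('k, 'g word \<Rightarrow>\<^sub>0 'k) module)"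
  proof (rule abelian_groupI)
    fix p assume "p \<in> carrier (free_algebra :: ('k, 'g word \<Rightarrow>\<^sub>0 'k) module)"
    show "\<exists>r\<in>carrier free_algebra. r \<oplus>\<^bsub>free_algebra\<^esub> p
        = \<zero>\<^bsub>free_algebra :: ('k, 'g word \<Rightarrow>\<^sub>0 'k) module\<^esub>"
      by (rule bexI[of _ "- p"]) (simp_all add: free_algebra_def)
  qed (simp_all add: free_algebra_def ac_simps)
  show "monoid (free_algebra :: ('k, 'g word \<Rightarrow>\<^sub>0 'k) module)"
    by (rule monoidI) (simp_all add: free_algebra_def ac_simps)
qed (simp_all add: free_algebra_def algebra_simps)

lemma ideal_smith_ideal: "ideal (smith_ideal q f) free_algebra"
  unfolding smith_ideal_def
  by (rule ring.genideal_ideal[OF ring_free_algebra]) (simp add: free_algebra_def)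

lemma smith_algebra_simps:
  "carrier (smith_algebra q f) = carrier (free_algebra Quot smith_ideal q f)"
  "monoid.mult (smith_algebra q f) = monoid.mult (free_algebra Quot smith_ideal q f)"
  "one (smith_algebra q f) = one (free_algebra Quot smith_ideal q f)"
  "zero (smith_algebra q f) = zero (free_algebra Quot smith_ideal q f)"
  "add (smith_algebra q f) = add (free_algebra Quot smith_ideal q f)"
  by (simp_all add: smith_algebra_def quotient_algebra_def ring.defs)

lemma ring_smith_algebra: "ring (smith_algebra q f)"
proof -
  interpret ring "free_algebra Quot smith_ideal q f"
    by (rule ideal.quotient_is_ring[OF ideal_smith_ideal])
  show ?thesis
  proof (rule ringI)
    show "abelian_group (smith_algebra q f)"
      by (rule abelian_groupI) (auto simp: smith_algebra_simps a_ac intro: l_neg bexI[OF _ a_inv_closed])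
    show "monoid (smith_algebra q f)"
      by (rule monoidI) (auto simp: smith_algebra_simps m_assoc)
  qed (auto simp: smith_algebra_simps l_distr r_distr)
qed

lemma smult_smith_algebra:
  "c \<odot>\<^bsub>smith_algebra q f\<^esub> (smith_ideal q f +>\<^bsub>free_algebra\<^esub> p)
    = smith_ideal q f +>\<^bsub>free_algebra\<^esub> (c \<odot>\<^bsub>free_algebra\<^esub> p)"
proof -
  have "c \<odot>\<^bsub>smith_algebra q f\<^esub> (smith_ideal q f +>\<^bsub>free_algebra\<^esub> p)
      = rcoset_mult free_algebra (smith_ideal q f)
          (smith_ideal q f +>\<^bsub>free_algebra\<^esub> (c \<odot>\<^bsub>free_algebra\<^esub> \<one>\<^bsub>free_algebra\<^esub>))
          (smith_ideal q f +>\<^bsub>free_algebra\<^esub> p)"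
    by (simp add: smith_algebra_def quotient_algebra_def ring.defs FactRing_def)
  also have "\<dots> = smith_ideal q f +>\<^bsub>free_algebra\<^esub>
      ((c \<odot>\<^bsub>free_algebra\<^esub> \<one>\<^bsub>free_algebra\<^esub>) \<otimes>\<^bsub>free_algebra\<^esub> p)"
    by (rule ideal.rcoset_mult_add[OF ideal_smith_ideal]) (simp_all add: free_algebra_def)
  finally show ?thesis
    by (simp add: free_algebra_def)
qed

end

theory Submission
  imports Defs
begin

text \<open>
  Send \<open>R(f)\<close> to the skew Laurent ring \<open>T = k[\<Omega>, h][x\<^sup>\<plusminus>\<^sup>1]\<close>, where \<open>xh = qhx\<close> and \<open>\<Omega>\<close> is central, by
  \<open>y \<mapsto> (\<Omega> + a(h)) x\<^sup>-\<^sup>1\<close>. Let \<open>g, p, s\<close> be the images in \<open>T\<close> of the generators \<open>h, x, y\<close> of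
  \<open>R(f\<^sub>1)\<close> under an isomorphism onto \<open>R(f\<^sub>2)\<close>. Commutators in \<open>R(f\<^sub>1)\<close> lie in \<open>h R(f\<^sub>1)\<close> because
  \<open>f\<^sub>1(0) = 0\<close>; as \<open>hx\<close> and \<open>hy\<close> are multiples of commutators, \<open>g\<close> is a left factor of both in the image
  of \<open>R(f\<^sub>2)\<close>. Since \<open>T\<close> is a graded domain, \<open>g\<close> is homogeneous; comparing factors shows that its degree
  is zero and that it divides \<open>h\<close>. It is not a scalar, for then \<open>p = s = 0\<close>; so \<open>g = \<beta>h\<close>. The
  relations then force \<open>p\<close> and \<open>s\<close> to have degree \<open>1\<close> and \<open>-1\<close>, and by surjectivity they are scalar
  multiples of \<open>x\<close> and \<open>y\<close>. Hence \<open>f\<^sub>1(\<beta>h)\<close> is a scalar multiple of \<open>f\<^sub>2(h)\<close>, which determines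
  \<open>a\<^sub>1\<close> up to its constant term as \<open>q\<^sup>n \<noteq> 1\<close> for \<open>n > 0\<close>. Conversely, rescaling the generators of the
  free algebra carries one ideal of relations to the other.
\<close>

section \<open>Free algebras\<close>

lemma poly_mapping_add_induct [case_names single add]:
  fixes p :: "'a \<Rightarrow>\<^sub>0 'b::comm_monoid_add"
  assumes single: "\<And>k v. P (Poly_Mapping.single k v)"
    and add: "\<And>a b. P a \<Longrightarrow> P b \<Longrightarrow> P (a + b)"
  shows "P p"
proof (induction p rule: update_induct)
  case const
  show ?case using single[of undefined 0] by simp
next
  case (update f k v)
  have "Poly_Mapping.update k v f = f + Poly_Mapping.single k v"
    using update(1) by (intro poly_mapping_eqI)
      (auto simp: lookup_update lookup_add lookup_single when_def in_keys_iff)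
  then show ?case using add[OF update(3) single[of k v]] by simp
qed

lemma poly_mapping_eq_singleI:
  assumes "\<And>j. j \<noteq> i \<Longrightarrow> Poly_Mapping.lookup s j = 0"
  shows "s = Poly_Mapping.single i (Poly_Mapping.lookup s i)"
  by (rule poly_mapping_eqI) (use assms in \<open>auto simp: lookup_single when_def\<close>)

lemma poly_mapping_eq_single_Max:
  fixes s :: "'a::linorder \<Rightarrow>\<^sub>0 'b::zero"
  assumes "Min (Poly_Mapping.keys s) = Max (Poly_Mapping.keys s)"
  shows "s = Poly_Mapping.single (Max (Poly_Mapping.keys s)) (Poly_Mapping.lookup s (Max (Poly_Mapping.keys s)))"
proof (rule poly_mapping_eq_singleI)
  fix j assume "j \<noteq> Max (Poly_Mapping.keys s)"
  then show "Poly_Mapping.lookup s j = 0"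
    using Max_ge[OF finite_keys, of j s] Min_le[OF finite_keys, of j s] assms
    by (metis in_keys_iff order_antisym)
qed

text \<open>A word arises by prepending letters one at a time, so left multiplication by generators
  together with sums reaches everything from the scalars. Divisibility of coefficients and
  containment of commutators are both proved along this induction.\<close>

lemma free_algebra_induct [case_names scalar add gen]:
  fixes p :: "'g word \<Rightarrow>\<^sub>0 'k::field"
  assumes scalar: "\<And>c. P (Poly_Mapping.single 0 c)"
    and add: "\<And>a b. P a \<Longrightarrow> P b \<Longrightarrow> P (a + b)"
    and gen: "\<And>g a. P a \<Longrightarrow> P (free_gen g * a)"
  shows "P p"
proof -
  have "P (Poly_Mapping.single (Word ls) v)" for ls v
  proof (induction ls)
    case Nil
    then show ?case using scalar[of v] by (simp add: zero_word_def)
  next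
    case (Cons g ls)
    then show ?case using gen[OF Cons, of g]
      by (simp add: free_gen_def mult_single plus_word_def)
  qed
  note word = this
  show ?thesis
  proof (induction p rule: poly_mapping_add_induct)
    case (single w v)
    then show ?case using word by (cases w) simp
  qed (rule add)
qed

lemma scalar_central:
  fixes p :: "'g word \<Rightarrow>\<^sub>0 'k::field"
  shows "Poly_Mapping.single 0 c * p = p * Poly_Mapping.single 0 c"
  by (induction p rule: poly_mapping_add_induct) (simp_all add: mult_single mult.commute algebra_simps)

lemma mult_scalar_left:
  fixes p :: "'g word \<Rightarrow>\<^sub>0 'k::field"
  shows "p * (Poly_Mapping.single 0 c * r) = Poly_Mapping.single 0 c * (p * r)"
  by (metis mult.assoc scalar_central)

lemma single_zero_mult:
  "Poly_Mapping.single 0 (c * d) = Poly_Mapping.single (0::'g word) (c::'k::field) * Poly_Mapping.single 0 d"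
  by (simp add: mult_single)

section \<open>The Smith algebra as a quotient of the free algebra\<close>

lemma ideal_free_algebraI:
  fixes J :: "('g word \<Rightarrow>\<^sub>0 'k::field) set"
  assumes "0 \<in> J" and add: "\<And>a b. a \<in> J \<Longrightarrow> b \<in> J \<Longrightarrow> a + b \<in> J"
    and l: "\<And>a r. a \<in> J \<Longrightarrow> r * a \<in> J" and r: "\<And>a r. a \<in> J \<Longrightarrow> a * r \<in> J"
  shows "ideal J (free_algebra :: ('k, 'g word \<Rightarrow>\<^sub>0 'k) module)"
proof -
  interpret ring "free_algebra :: ('k, 'g word \<Rightarrow>\<^sub>0 'k) module"
    by (rule ring_free_algebra)
  have inv: "\<ominus>\<^bsub>free_algebra\<^esub> a = - a" for a :: "'g word \<Rightarrow>\<^sub>0 'k"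
    by (rule minus_equality) (simp_all add: free_algebra_def)
  show ?thesis
  proof (rule idealI[OF ring_free_algebra])
    show "subgroup J (add_monoid free_algebra)"
    proof (rule add.subgroupI)
      fix a assume "a \<in> J"
      then show "\<ominus>\<^bsub>free_algebra\<^esub> a \<in> J" using l[of a "- 1"] by (simp add: inv)
    qed (use assms in \<open>auto simp: free_algebra_def\<close>)
  qed (use l r in \<open>auto simp: free_algebra_def\<close>)
qed

lemma smith_ideal_closed:
  fixes a b r :: "smith_gen word \<Rightarrow>\<^sub>0 'k::field"
  shows "0 \<in> smith_ideal q f"
    and "a \<in> smith_ideal q f \<Longrightarrow> b \<in> smith_ideal q f \<Longrightarrow> a + b \<in> smith_ideal q f"
    and "a \<in> smith_ideal q f \<Longrightarrow> r * a \<in> smith_ideal q f"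
    and "a \<in> smith_ideal q f \<Longrightarrow> a * r \<in> smith_ideal q f"
proof -
  interpret ideal "smith_ideal q f" free_algebra by (rule ideal_smith_ideal)
  show "0 \<in> smith_ideal q f" using additive_subgroup.zero_closed[OF is_additive_subgroup] by (simp add: free_algebra_def)
  show "a \<in> smith_ideal q f \<Longrightarrow> b \<in> smith_ideal q f \<Longrightarrow> a + b \<in> smith_ideal q f"
    using additive_subgroup.a_closed[OF is_additive_subgroup, of a b] by (simp add: free_algebra_def)
  show "a \<in> smith_ideal q f \<Longrightarrow> r * a \<in> smith_ideal q f"
    using I_l_closed[of a r] by (simp add: free_algebra_def)
  show "a \<in> smith_ideal q f \<Longrightarrow> a * r \<in> smith_ideal q f"
    using I_r_closed[of a r] by (simp add: free_algebra_def)
qed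

lemma smith_ideal_minus:
  fixes a :: "smith_gen word \<Rightarrow>\<^sub>0 'k::field"
  shows "a \<in> smith_ideal q f \<Longrightarrow> - a \<in> smith_ideal q f"
  using smith_ideal_closed(3)[of a q f "- 1"] by simp

lemma smith_ideal_least:
  fixes J :: "(smith_gen word \<Rightarrow>\<^sub>0 'k::field) set"
  assumes "ideal J free_algebra" "smith_relators q f \<subseteq> J"
  shows "smith_ideal q f \<subseteq> J"
  unfolding smith_ideal_def using assms by (intro ring.genideal_minimal[OF ring_free_algebra])

lemma smith_relator_mem:
  "free_gen smith_gen.X * free_gen H - Poly_Mapping.single 0 q * free_gen H * free_gen smith_gen.X \<in> smith_ideal q f"
  "free_gen H * free_gen Y - Poly_Mapping.single 0 q * free_gen Y * free_gen H \<in> smith_ideal q f"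
  "free_gen smith_gen.X * free_gen Y - free_gen Y * free_gen smith_gen.X - free_eval f (free_gen H) \<in> smith_ideal q f"
proof -
  have "smith_relators q f \<subseteq> smith_ideal q f"
    unfolding smith_ideal_def
    by (rule ring.genideal_self[OF ring_free_algebra]) (simp add: free_algebra_def)
  then show
  "free_gen smith_gen.X * free_gen H - Poly_Mapping.single 0 q * free_gen H * free_gen smith_gen.X \<in> smith_ideal q f"
  "free_gen H * free_gen Y - Poly_Mapping.single 0 q * free_gen Y * free_gen H \<in> smith_ideal q f"
  "free_gen smith_gen.X * free_gen Y - free_gen Y * free_gen smith_gen.X - free_eval f (free_gen H) \<in> smith_ideal q f"
    by (auto simp: smith_relators_def Let_def)
qed

section \<open>Residue classes modulo the ideal of relations\<close>

definition smith_class :: "'k::field \<Rightarrow> 'k poly \<Rightarrow> (smith_gen word \<Rightarrow>\<^sub>0 'k) \<Rightarrow> (smith_gen word \<Rightarrow>\<^sub>0 'k) set"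
  where "smith_class q f p = smith_ideal q f +>\<^bsub>free_algebra\<^esub> p"

lemma smith_class_alt: "smith_class q f p = (\<lambda>i. i + p) ` smith_ideal q f"
  by (auto simp: smith_class_def a_r_coset_def' free_algebra_def)

lemma smith_class_eq_iff: "smith_class q f p = smith_class q f r \<longleftrightarrow> p - r \<in> smith_ideal q f"
proof
  assume eq: "smith_class q f p = smith_class q f r"
  have "p \<in> smith_class q f p" unfolding smith_class_alt
    by (rule image_eqI[of _ _ 0]) (auto simp: smith_ideal_closed)
  with eq show "p - r \<in> smith_ideal q f" unfolding smith_class_alt by auto
next
  assume *: "p - r \<in> smith_ideal q f"
  have 1: "i + (p - r) \<in> smith_ideal q f" if "i \<in> smith_ideal q f" for i
    using smith_ideal_closed(2)[OF that *] .
  have 2: "i - (p - r) \<in> smith_ideal q f" if "i \<in> smith_ideal q f" for i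
    using smith_ideal_closed(2)[OF that smith_ideal_minus[OF *]] by (simp add: algebra_simps)
  show "smith_class q f p = smith_class q f r" unfolding smith_class_alt
  proof (intro equalityI subsetI)
    fix z assume "z \<in> (\<lambda>i. i + p) ` smith_ideal q f"
    then obtain i where "i \<in> smith_ideal q f" "z = i + p" by auto
    with 1[of i] show "z \<in> (\<lambda>i. i + r) ` smith_ideal q f"
      by (intro image_eqI[of _ _ "i + (p - r)"]) auto
  next
    fix z assume "z \<in> (\<lambda>i. i + r) ` smith_ideal q f"
    then obtain i where "i \<in> smith_ideal q f" "z = i + r" by auto
    with 2[of i] show "z \<in> (\<lambda>i. i + p) ` smith_ideal q f"
      by (intro image_eqI[of _ _ "i - (p - r)"]) auto
  qed
qed

lemma carrier_smith_algebra: "carrier (smith_algebra q f) = range (smith_class q f)"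
  by (auto simp: smith_algebra_simps FactRing_def A_RCOSETS_def' smith_class_def free_algebra_def)

lemma smith_class_add:
  "smith_class q f p \<oplus>\<^bsub>smith_algebra q f\<^esub> smith_class q f r = smith_class q f (p + r)"
proof -
  interpret ideal "smith_ideal q f" free_algebra by (rule ideal_smith_ideal)
  show ?thesis using a_rcos_sum[of p r]
    by (simp add: smith_algebra_simps FactRing_def smith_class_def free_algebra_def)
qed

lemma smith_class_mult:
  "smith_class q f p \<otimes>\<^bsub>smith_algebra q f\<^esub> smith_class q f r = smith_class q f (p * r)"
proof -
  interpret ideal "smith_ideal q f" free_algebra by (rule ideal_smith_ideal)
  show ?thesis using rcoset_mult_add[of p r]
    by (simp add: smith_algebra_simps FactRing_def smith_class_def free_algebra_def)
qed

lemma smith_class_one: "\<one>\<^bsub>smith_algebra q f\<^esub> = smith_class q f 1"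
  by (simp add: smith_algebra_simps FactRing_def smith_class_def free_algebra_def)

lemma smith_class_smult:
  "c \<odot>\<^bsub>smith_algebra q f\<^esub> smith_class q f p = smith_class q f (Poly_Mapping.single 0 c * p)"
  using smult_smith_algebra[where c = c and q = q and f = f and p = p] by (simp add: smith_class_def free_algebra_def)

text \<open>An endomorphism of the free algebra descends to the quotients when it respects the
  ideals. In \<open>mem\<close>, one direction makes the induced map well defined and the other
  makes it injective; \<open>surj\<close> gives surjectivity.\<close>

lemma smith_algebra_isoI:
  fixes q :: "'k::field" and \<theta> :: "(smith_gen word \<Rightarrow>\<^sub>0 'k::field) \<Rightarrow> (smith_gen word \<Rightarrow>\<^sub>0 'k)"
  assumes add: "\<And>p r. \<theta> (p + r) = \<theta> p + \<theta> r" and mult: "\<And>p r. \<theta> (p * r) = \<theta> p * \<theta> r"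
    and scal: "\<And>c. \<theta> (Poly_Mapping.single 0 c) = Poly_Mapping.single 0 c"
    and surj: "surj \<theta>" and mem: "\<And>p. \<theta> p \<in> smith_ideal q f2 \<longleftrightarrow> p \<in> smith_ideal q f1"
  shows "algebra_iso (smith_algebra q f1) (smith_algebra q f2) \<noteq> {}"
proof -
  \<comment> \<open>A class is mapped through an arbitrary representative; \<open>eq\<close> shows
    that the choice does not matter.\<close>
  define \<phi> where "\<phi> S = smith_class q f2 (\<theta> (SOME p. S = smith_class q f1 p))" for S
  have diff: "\<theta> (p - r) = \<theta> p - \<theta> r" for p r
    using add[of "p - r" r] by (simp add: algebra_simps)
  have eq: "smith_class q f2 (\<theta> p) = smith_class q f2 (\<theta> r) \<longleftrightarrow> smith_class q f1 p = smith_class q f1 r" for p r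
    by (simp add: smith_class_eq_iff mem flip: diff)
  have \<phi>: "\<phi> (smith_class q f1 p) = smith_class q f2 (\<theta> p)" for p
    unfolding \<phi>_def eq by (rule someI2[of _ p]) auto
  have one: "\<theta> 1 = 1" using scal[of 1] by simp
  have "\<phi> \<in> ring_hom (smith_algebra q f1) (smith_algebra q f2)"
    by (rule ring_hom_memI)
      (auto simp: carrier_smith_algebra smith_class_add smith_class_mult smith_class_one \<phi> add mult one)
  moreover have "bij_betw \<phi> (carrier (smith_algebra q f1)) (carrier (smith_algebra q f2))"
  proof (rule bij_betw_imageI)
    show "inj_on \<phi> (carrier (smith_algebra q f1))"
      by (auto simp: inj_on_def carrier_smith_algebra \<phi> eq)
    show "\<phi> ` carrier (smith_algebra q f1) = carrier (smith_algebra q f2)"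
      using surj by (auto simp: carrier_smith_algebra \<phi> image_iff surj_def) metis
  qed
  ultimately have "\<phi> \<in> algebra_iso (smith_algebra q f1) (smith_algebra q f2)"
    by (auto simp: algebra_iso_def ring_iso_def carrier_smith_algebra smith_class_smult \<phi> mult scal)
  then show ?thesis by blast
qed

section \<open>Rescaling the generators\<close>

definition scale_word :: "('g \<Rightarrow> 'k::field) \<Rightarrow> 'g word \<Rightarrow> 'k"
  where "scale_word c w = prod_list (map c (letters w))"

text \<open>The endomorphism sending each generator g to c(g) g is diagonal in the basis of words,
  so it can be given coefficientwise with the eigenvalue \<open>scale_word c w\<close> at the word
  w.\<close>

definition rescale :: "('g \<Rightarrow> 'k::field) \<Rightarrow> ('g word \<Rightarrow>\<^sub>0 'k) \<Rightarrow> ('g word \<Rightarrow>\<^sub>0 'k)"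
  where "rescale c p = Poly_Mapping.mapp (\<lambda>w v. v * scale_word c w) p"

lemma lookup_rescale: "Poly_Mapping.lookup (rescale c p) w = Poly_Mapping.lookup p w * scale_word c w"
  by (simp add: rescale_def lookup_mapp in_keys_iff when_def)

lemma rescale_single:
  "rescale c (Poly_Mapping.single w v) = Poly_Mapping.single w (v * scale_word c w)"
  by (rule poly_mapping_eqI) (simp add: lookup_rescale lookup_single when_def)

lemma rescale_add: "rescale c (p + r) = rescale c p + rescale c r"
  by (rule poly_mapping_eqI) (simp add: lookup_rescale lookup_add algebra_simps)

lemma rescale_diff: "rescale c (p - r) = rescale c p - rescale c r"
  by (rule poly_mapping_eqI) (simp add: lookup_rescale lookup_minus algebra_simps)

lemma rescale_mult: "rescale c (p * r) = rescale c p * rescale c r"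
proof (induction p rule: poly_mapping_add_induct)
  case (single k v)
  show ?case
    by (induction r rule: poly_mapping_add_induct)
      (simp_all add: mult_single rescale_single rescale_add algebra_simps scale_word_def plus_word_def)
qed (simp add: rescale_add algebra_simps)

lemma rescale_scalar: "rescale c (Poly_Mapping.single 0 v) = Poly_Mapping.single 0 v"
  by (simp add: rescale_single scale_word_def zero_word_def)

lemma rescale_gen: "rescale c (free_gen g) = Poly_Mapping.single 0 (c g) * free_gen g"
  by (simp add: free_gen_def rescale_single mult_single scale_word_def)

lemma rescale_rescale:
  assumes "\<And>g. c g * d g = 1"
  shows "rescale c (rescale d p) = p"
proof -
  have "scale_word c w * scale_word d w = 1" for w
  proof -
    have "prod_list (map c ls) * prod_list (map d ls) = 1" for ls
    proof (induction ls)
      case (Cons g ls)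
      have "c g * prod_list (map c ls) * (d g * prod_list (map d ls))
        = (c g * d g) * (prod_list (map c ls) * prod_list (map d ls))" by (simp only: ac_simps)
      then show ?case using Cons assms by simp
    qed simp
    then show ?thesis by (simp add: scale_word_def)
  qed
  then have "scale_word d w * scale_word c w = 1" for w by (metis mult.commute)
  then show ?thesis
    by (intro poly_mapping_eqI) (simp add: lookup_rescale mult.assoc)
qed

lemma rescale_sum: "rescale c (\<Sum>i\<in>A. g i) = (\<Sum>i\<in>A. rescale c (g i))"
  by (induction A rule: infinite_finite_induct) (simp_all add: rescale_add rescale_scalar[of _ 0, simplified])

lemma rescale_power: "rescale c (p ^ n) = rescale c p ^ n"
  by (induction n) (simp_all add: rescale_mult rescale_scalar[of _ 1, simplified])

lemma scalar_mult_power: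
  fixes p :: "'g word \<Rightarrow>\<^sub>0 'k::field"
  shows "(Poly_Mapping.single 0 c * p) ^ n = Poly_Mapping.single 0 (c ^ n) * p ^ n"
proof (induction n)
  case (Suc n)
  then show ?case
    by (simp add: mult.assoc single_zero_mult mult_scalar_left[of p])
qed simp

text \<open>Any degree bound may replace the exact degree, so that two polynomials can be evaluated
  over the same range of summation.\<close>

lemma free_eval_bound:
  assumes "degree f \<le> n"
  shows "free_eval f p = (\<Sum>i\<le>n. Poly_Mapping.single 0 (coeff f i) * p ^ i)"
  unfolding free_eval_def
  by (rule sum.mono_neutral_left) (use assms in \<open>auto simp: coeff_eq_0\<close>)

text \<open>Each relator for f1 goes to a scalar multiple of the matching relator for f2. The two
  q-commutation relators are homogeneous in the generators and scale in any case. The assumption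
  \<open>cf\<close> says f1(c(H) h) = c(X) c(Y) f2(h), so all terms of the third relator acquire the
  factor c(X) c(Y).\<close>

lemma rescale_smith_ideal:
  fixes c :: "smith_gen \<Rightarrow> 'k::field"
  assumes cf: "\<And>i. coeff f1 i * c H ^ i = c smith_gen.X * c Y * coeff f2 i"
    and mem: "p \<in> smith_ideal q f1"
  shows "rescale c p \<in> smith_ideal q f2"
proof -
  let ?x = "free_gen smith_gen.X :: smith_gen word \<Rightarrow>\<^sub>0 'k" and ?y = "free_gen Y :: smith_gen word \<Rightarrow>\<^sub>0 'k"
    and ?h = "free_gen H :: smith_gen word \<Rightarrow>\<^sub>0 'k"
  let ?s = "Poly_Mapping.single (0 :: smith_gen word) :: 'k \<Rightarrow> _"
  have gg: "rescale c (free_gen g * free_gen g') = ?s (c g * c g') * (free_gen g * free_gen g')" for g g'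
  proof -
    show ?thesis
      by (simp add: rescale_mult rescale_gen mult.assoc single_zero_mult mult_scalar_left[of "free_gen g"])
  qed
  have sgg: "rescale c (?s q * free_gen g * free_gen g') = ?s (c g * c g') * (?s q * free_gen g * free_gen g')" for g g'
  proof -
    have "rescale c (?s q * free_gen g * free_gen g') = ?s q * (?s (c g * c g') * (free_gen g * free_gen g'))"
      by (simp add: mult.assoc rescale_mult[of _ "?s q"] rescale_scalar gg)
    also have "\<dots> = ?s (c g * c g') * (?s q * free_gen g * free_gen g')"
      by (simp only: mult_scalar_left[of "?s q"] mult.assoc)
    finally show ?thesis .
  qed
  have ev: "rescale c (free_eval f1 ?h) = ?s (c smith_gen.X * c Y) * free_eval f2 ?h"
  proof -
    define n where "n = max (degree f1) (degree f2)"
    have "rescale c (free_eval f1 ?h) = (\<Sum>i\<le>n. ?s (coeff f1 i * c H ^ i) * ?h ^ i)"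
      unfolding free_eval_bound[of f1 n, unfolded n_def, simplified, folded n_def]
      by (simp add: rescale_sum rescale_mult rescale_scalar rescale_power rescale_gen scalar_mult_power
          mult.assoc single_zero_mult)
    also have "\<dots> = ?s (c smith_gen.X * c Y) * (\<Sum>i\<le>n. ?s (coeff f2 i) * ?h ^ i)"
      unfolding cf by (simp add: sum_distrib_left single_zero_mult mult.assoc)
    finally show ?thesis
      unfolding free_eval_bound[of f2 n, unfolded n_def, simplified, folded n_def] .
  qed
  \<comment> \<open>The preimage of an ideal under \<open>rescale c\<close> is an ideal, so the
    relators decide.\<close>
  have "smith_ideal q f1 \<subseteq> {p. rescale c p \<in> smith_ideal q f2}"
  proof (rule smith_ideal_least)
    show "ideal {p. rescale c p \<in> smith_ideal q f2} free_algebra"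
      by (rule ideal_free_algebraI)
        (simp_all add: rescale_add rescale_mult smith_ideal_closed rescale_scalar[of _ 0, simplified])
    have "rescale c (?x * ?h - ?s q * ?h * ?x) = ?s (c smith_gen.X * c H) * (?x * ?h - ?s q * ?h * ?x)"
      by (simp only: rescale_diff gg sgg right_diff_distrib mult.commute[of "c H"])
    moreover have "rescale c (?h * ?y - ?s q * ?y * ?h) = ?s (c H * c Y) * (?h * ?y - ?s q * ?y * ?h)"
      by (simp only: rescale_diff gg sgg right_diff_distrib mult.commute[of "c Y"])
    moreover have "rescale c (?x * ?y - ?y * ?x - free_eval f1 ?h)
        = ?s (c smith_gen.X * c Y) * (?x * ?y - ?y * ?x - free_eval f2 ?h)"
      by (simp only: rescale_diff gg ev right_diff_distrib mult.commute[of "c Y"])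
    ultimately show "smith_relators q f1 \<subseteq> {p. rescale c p \<in> smith_ideal q f2}"
      unfolding smith_relators_def Let_def
      by (auto simp only: insert_iff empty_iff mem_Collect_eq intro!: smith_ideal_closed(3) smith_relator_mem)
  qed
  with mem show ?thesis by blast
qed

lemma smith_algebra_iso_of_scaling:
  fixes f1 f2 :: "'k::field poly"
  assumes cf: "\<And>i. coeff f1 i * \<gamma> ^ i = \<rho> * coeff f2 i" and "\<gamma> \<noteq> 0" "\<rho> \<noteq> 0"
  shows "algebra_iso (smith_algebra q f1) (smith_algebra q f2) \<noteq> {}"
proof -
  \<comment> \<open>Only the product of the factors of x and y enters the third relation, so \<rho>
    is put on x and y stays fixed.\<close>
  define c where "c g = (case g of smith_gen.X \<Rightarrow> \<rho> | Y \<Rightarrow> 1 | H \<Rightarrow> \<gamma>)" for g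
  define d where "d g = inverse (c g)" for g
  have cd: "c g * d g = 1" "d g * c g = 1" for g
    using assms(2,3) by (auto simp: d_def c_def split: smith_gen.split)
  have 1: "rescale c p \<in> smith_ideal q f2" if "p \<in> smith_ideal q f1" for p
    by (rule rescale_smith_ideal[OF _ that]) (simp add: c_def cf)
  \<comment> \<open>The inverse scaling satisfies the same condition with f1 and f2 exchanged; this
    yields the converse membership.\<close>
  have 2: "rescale d p \<in> smith_ideal q f1" if "p \<in> smith_ideal q f2" for p
  proof (rule rescale_smith_ideal[OF _ that])
    fix i show "coeff f2 i * d H ^ i = d smith_gen.X * d Y * coeff f1 i"
      using cf[of i] assms(2,3) by (simp add: d_def c_def field_simps)
  qed
  show ?thesis
  proof (rule smith_algebra_isoI)
    show "surj (rescale c)" by (rule surjI[of _ "rescale d"]) (rule rescale_rescale, rule cd)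
    show "rescale c p \<in> smith_ideal q f2 \<longleftrightarrow> p \<in> smith_ideal q f1" for p
      using 1 2[of "rescale c p"] by (auto simp: rescale_rescale[OF cd(2)])
  qed (simp_all add: rescale_add rescale_mult rescale_scalar)
qed

section \<open>Twisted Laurent polynomials\<close>

text \<open>An action of the integers by automorphisms of a domain that fix the image of the
  scalars: the data of a skew Laurent ring in one variable x.\<close>

locale twisted_laurent =
  fixes \<sigma> :: "int \<Rightarrow> 'p::idom \<Rightarrow> 'p" and \<iota> :: "'k::field \<Rightarrow> 'p"
  assumes \<sigma>_add: "\<sigma> i (a + b) = \<sigma> i a + \<sigma> i b"
    and \<sigma>_mult: "\<sigma> i (a * b) = \<sigma> i a * \<sigma> i b"
    and \<sigma>_one: "\<sigma> i 1 = 1"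
    and \<sigma>_zero_exp: "\<sigma> 0 a = a"
    and \<sigma>_\<sigma>: "\<sigma> i (\<sigma> j a) = \<sigma> (i + j) a"
    and \<iota>_add: "\<iota> (c + d) = \<iota> c + \<iota> d"
    and \<iota>_mult: "\<iota> (c * d) = \<iota> c * \<iota> d"
    and \<iota>_one: "\<iota> 1 = 1"
    and \<sigma>_\<iota>: "\<sigma> i (\<iota> c) = \<iota> c"
begin

lemma \<iota>_zero: "\<iota> 0 = 0"
  using \<iota>_add[of 0 0] by (simp only: add_0_left add_cancel_right_right)

lemma \<sigma>_zero: "\<sigma> i 0 = 0"
  using \<sigma>_add[of i 0 0] by (simp only: add_0_left add_cancel_right_right)

lemma \<sigma>_eq_0_iff: "\<sigma> i a = 0 \<longleftrightarrow> a = 0"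
  using \<sigma>_\<sigma>[of "- i" i a] by (auto simp: \<sigma>_zero \<sigma>_zero_exp)

lemma \<sigma>_prod: "\<sigma> i (\<Prod>j\<in>A. g j) = (\<Prod>j\<in>A. \<sigma> i (g j))"
  by (induction A rule: infinite_finite_induct) (simp_all add: \<sigma>_one \<sigma>_mult)

text \<open>A finitely supported \<open>s\<close> stands for \<open>\<Sum>i. s i x\<^sup>i\<close>, where \<open>x\<^sup>i a = \<sigma> i a x\<^sup>i\<close>.\<close>

definition tmul :: "(int \<Rightarrow>\<^sub>0 'p) \<Rightarrow> (int \<Rightarrow>\<^sub>0 'p) \<Rightarrow> (int \<Rightarrow>\<^sub>0 'p)"
  where "tmul s t = (\<Sum>i\<in>Poly_Mapping.keys s. \<Sum>j\<in>Poly_Mapping.keys t.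
    Poly_Mapping.single (i + j) (Poly_Mapping.lookup s i * \<sigma> i (Poly_Mapping.lookup t j)))"

text \<open>The sum may run over any finite set containing the left support, so that products with
  different left factors can be added over one index set.\<close>

lemma lookup_tmul:
  assumes "finite A" "Poly_Mapping.keys s \<subseteq> A"
  shows "Poly_Mapping.lookup (tmul s t) n = (\<Sum>i\<in>A. Poly_Mapping.lookup s i * \<sigma> i (Poly_Mapping.lookup t (n - i)))"
proof -
  have inner: "(\<Sum>j\<in>Poly_Mapping.keys t. Poly_Mapping.lookup (Poly_Mapping.single (i + j) (Poly_Mapping.lookup s i * \<sigma> i (Poly_Mapping.lookup t j))) n)
      = Poly_Mapping.lookup s i * \<sigma> i (Poly_Mapping.lookup t (n - i))" for i
  proof -
    have "(\<Sum>j\<in>Poly_Mapping.keys t. Poly_Mapping.lookup (Poly_Mapping.single (i + j) (Poly_Mapping.lookup s i * \<sigma> i (Poly_Mapping.lookup t j))) n)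
      = (\<Sum>j\<in>Poly_Mapping.keys t. if j = n - i then Poly_Mapping.lookup s i * \<sigma> i (Poly_Mapping.lookup t j) else 0)"
      by (rule sum.cong) (auto simp: lookup_single when_def)
    also have "\<dots> = Poly_Mapping.lookup s i * \<sigma> i (Poly_Mapping.lookup t (n - i))"
      by (simp add: in_keys_iff \<sigma>_zero)
    finally show ?thesis .
  qed
  have "Poly_Mapping.lookup (tmul s t) n = (\<Sum>i\<in>Poly_Mapping.keys s. Poly_Mapping.lookup s i * \<sigma> i (Poly_Mapping.lookup t (n - i)))"
    by (simp add: tmul_def lookup_sum inner)
  also have "\<dots> = (\<Sum>i\<in>A. Poly_Mapping.lookup s i * \<sigma> i (Poly_Mapping.lookup t (n - i)))"
    by (rule sum.mono_neutral_left) (use assms in \<open>auto simp: in_keys_iff\<close>)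
  finally show ?thesis .
qed

lemma tmul_add_left: "tmul (s + s') t = tmul s t + tmul s' t"
proof (rule poly_mapping_eqI)
  fix n
  let ?A = "Poly_Mapping.keys s \<union> Poly_Mapping.keys s'"
  have "Poly_Mapping.keys (s + s') \<subseteq> ?A" by (rule keys_add)
  then show "Poly_Mapping.lookup (tmul (s + s') t) n = Poly_Mapping.lookup (tmul s t + tmul s' t) n"
    by (simp add: lookup_tmul[of ?A] lookup_add algebra_simps sum.distrib)
qed

lemma tmul_add_right: "tmul s (t + t') = tmul s t + tmul s t'"
  by (rule poly_mapping_eqI)
    (simp add: lookup_tmul[OF finite_keys subset_refl] lookup_add algebra_simps \<sigma>_add sum.distrib)

lemma lookup_tmul_single_left:
  "Poly_Mapping.lookup (tmul (Poly_Mapping.single i a) t) n = a * \<sigma> i (Poly_Mapping.lookup t (n - i))"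
  by (subst lookup_tmul[of "{i}"]) auto

lemma lookup_tmul_single_right:
  "Poly_Mapping.lookup (tmul s (Poly_Mapping.single j b)) n = Poly_Mapping.lookup s (n - j) * \<sigma> (n - j) b"
proof -
  have "Poly_Mapping.lookup (tmul s (Poly_Mapping.single j b)) n
      = (\<Sum>i\<in>Poly_Mapping.keys s. if i = n - j then Poly_Mapping.lookup s i * \<sigma> i b else 0)"
    unfolding lookup_tmul[OF finite_keys subset_refl]
    by (rule sum.cong) (auto simp: lookup_single when_def \<sigma>_zero)
  also have "\<dots> = Poly_Mapping.lookup s (n - j) * \<sigma> (n - j) b"
    by (simp add: in_keys_iff)
  finally show ?thesis .
qed

lemma tmul_single_single:
  "tmul (Poly_Mapping.single i a) (Poly_Mapping.single j b) = Poly_Mapping.single (i + j) (a * \<sigma> i b)"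
  by (rule poly_mapping_eqI) (auto simp: lookup_tmul_single_left lookup_single when_def \<sigma>_zero)

section \<open>Extreme degrees and homogeneous factors\<close>

text \<open>In the top degree only the two leading terms meet; their product is nonzero because the
  coefficients form a domain and each \<sigma> i is injective.\<close>

lemma lookup_tmul_Max:
  assumes "s \<noteq> 0" "t \<noteq> 0"
  defines "m \<equiv> Max (Poly_Mapping.keys s)" and "n \<equiv> Max (Poly_Mapping.keys t)"
  shows "Poly_Mapping.lookup (tmul s t) (m + n) \<noteq> 0"
proof -
  have m: "m \<in> Poly_Mapping.keys s" and n: "n \<in> Poly_Mapping.keys t"
    using assms by (simp_all add: m_def n_def)
  have "Poly_Mapping.lookup (tmul s t) (m + n) = (\<Sum>i\<in>Poly_Mapping.keys s. if i = m then Poly_Mapping.lookup s m * \<sigma> m (Poly_Mapping.lookup t n) else 0)"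
    unfolding lookup_tmul[OF finite_keys subset_refl]
  proof (rule sum.cong[OF refl])
    fix i assume i: "i \<in> Poly_Mapping.keys s"
    show "Poly_Mapping.lookup s i * \<sigma> i (Poly_Mapping.lookup t (m + n - i)) = (if i = m then Poly_Mapping.lookup s m * \<sigma> m (Poly_Mapping.lookup t n) else 0)"
    proof (cases "i = m")
      case False
      moreover have "i \<le> m" unfolding m_def by (rule Max_ge[OF finite_keys i])
      ultimately have "m + n - i > n" by linarith
      then have "m + n - i \<notin> Poly_Mapping.keys t" using Max_ge[OF finite_keys] by (force simp: n_def)
      then show ?thesis using False by (simp add: in_keys_iff \<sigma>_zero)
    qed simp
  qed
  also have "\<dots> = Poly_Mapping.lookup s m * \<sigma> m (Poly_Mapping.lookup t n)" using m by simp
  finally show ?thesis using m n by (simp add: in_keys_iff \<sigma>_eq_0_iff)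
qed

lemma lookup_tmul_Min:
  assumes "s \<noteq> 0" "t \<noteq> 0"
  defines "m \<equiv> Min (Poly_Mapping.keys s)" and "n \<equiv> Min (Poly_Mapping.keys t)"
  shows "Poly_Mapping.lookup (tmul s t) (m + n) \<noteq> 0"
proof -
  have m: "m \<in> Poly_Mapping.keys s" and n: "n \<in> Poly_Mapping.keys t"
    using assms by (simp_all add: m_def n_def)
  have "Poly_Mapping.lookup (tmul s t) (m + n) = (\<Sum>i\<in>Poly_Mapping.keys s. if i = m then Poly_Mapping.lookup s m * \<sigma> m (Poly_Mapping.lookup t n) else 0)"
    unfolding lookup_tmul[OF finite_keys subset_refl]
  proof (rule sum.cong[OF refl])
    fix i assume i: "i \<in> Poly_Mapping.keys s"
    show "Poly_Mapping.lookup s i * \<sigma> i (Poly_Mapping.lookup t (m + n - i)) = (if i = m then Poly_Mapping.lookup s m * \<sigma> m (Poly_Mapping.lookup t n) else 0)"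
    proof (cases "i = m")
      case False
      moreover have "m \<le> i" unfolding m_def by (rule Min_le[OF finite_keys i])
      ultimately have "m + n - i < n" by linarith
      then have "m + n - i \<notin> Poly_Mapping.keys t" using Min_le[OF finite_keys] by (force simp: n_def)
      then show ?thesis using False by (simp add: in_keys_iff \<sigma>_zero)
    qed simp
  qed
  also have "\<dots> = Poly_Mapping.lookup s m * \<sigma> m (Poly_Mapping.lookup t n)" using m by simp
  finally show ?thesis using m n by (simp add: in_keys_iff \<sigma>_eq_0_iff)
qed

text \<open>Both the highest and the lowest degrees of the factors add up to n. Hence the
  nonnegative spreads of the two factors sum to zero, and each factor is a monomial.\<close>

lemma factors_homogeneous:
  assumes st: "tmul s t = Poly_Mapping.single n c" and "c \<noteq> 0"
  obtains i a b where "s = Poly_Mapping.single i a" "t = Poly_Mapping.single (n - i) b" "c = a * \<sigma> i b"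
proof -
  have "s \<noteq> 0" using st \<open>c \<noteq> 0\<close> by (auto simp: tmul_def) (metis lookup_single_eq lookup_zero)
  moreover have "t \<noteq> 0" using st \<open>c \<noteq> 0\<close> by (auto simp: tmul_def) (metis lookup_single_eq lookup_zero)
  ultimately have
    1: "Max (Poly_Mapping.keys s) + Max (Poly_Mapping.keys t) = n"
    and 2: "Min (Poly_Mapping.keys s) + Min (Poly_Mapping.keys t) = n"
    using lookup_tmul_Max[of s t] lookup_tmul_Min[of s t] by (auto simp: st lookup_single when_def split: if_splits)
  have "Min (Poly_Mapping.keys s) \<le> Max (Poly_Mapping.keys s)" "Min (Poly_Mapping.keys t) \<le> Max (Poly_Mapping.keys t)"
    using \<open>s \<noteq> 0\<close> \<open>t \<noteq> 0\<close> by simp_all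
  with 1 2 have eq: "Min (Poly_Mapping.keys s) = Max (Poly_Mapping.keys s)"
      "Min (Poly_Mapping.keys t) = Max (Poly_Mapping.keys t)" by linarith+
  define i where "i = Max (Poly_Mapping.keys s)"
  have s: "s = Poly_Mapping.single i (Poly_Mapping.lookup s i)"
    using poly_mapping_eq_single_Max[OF eq(1)] by (simp only: i_def)
  have t: "t = Poly_Mapping.single (n - i) (Poly_Mapping.lookup t (n - i))"
  proof -
    have "Max (Poly_Mapping.keys t) = n - i" using 1 by (simp add: i_def)
    then show ?thesis using poly_mapping_eq_single_Max[OF eq(2)] by (simp only:)
  qed
  have "Poly_Mapping.single n c = Poly_Mapping.single n (Poly_Mapping.lookup s i * \<sigma> i (Poly_Mapping.lookup t (n - i)))"
    using tmul_single_single[of i "Poly_Mapping.lookup s i" "n - i" "Poly_Mapping.lookup t (n - i)"] st s t by simp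
  then have "c = Poly_Mapping.lookup s i * \<sigma> i (Poly_Mapping.lookup t (n - i))" by (metis lookup_single_eq)
  with that s t show ?thesis by blast
qed

section \<open>Homomorphisms from the free algebra to skew Laurent polynomials\<close>

text \<open>Only the target is graded: no degree is prescribed for the images of the generators,
  since under an isomorphism these are not known in advance to be homogeneous.\<close>

definition graded_hom :: "((smith_gen word \<Rightarrow>\<^sub>0 'k) \<Rightarrow> (int \<Rightarrow>\<^sub>0 'p)) \<Rightarrow> bool"
  where "graded_hom \<Psi> \<longleftrightarrow> (\<forall>a b. \<Psi> (a + b) = \<Psi> a + \<Psi> b) \<and> (\<forall>a b. \<Psi> (a * b) = tmul (\<Psi> a) (\<Psi> b))
    \<and> (\<forall>c. \<Psi> (Poly_Mapping.single 0 c) = Poly_Mapping.single 0 (\<iota> c))"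

lemma graded_homD:
  assumes "graded_hom \<Psi>"
  shows "\<Psi> (a + b) = \<Psi> a + \<Psi> b" and "\<Psi> (a * b) = tmul (\<Psi> a) (\<Psi> b)"
    and "\<Psi> (Poly_Mapping.single 0 c) = Poly_Mapping.single 0 (\<iota> c)"
    and "\<Psi> 0 = 0" and "\<Psi> (a - b) = \<Psi> a - \<Psi> b"
proof -
  show add: "\<Psi> (a + b) = \<Psi> a + \<Psi> b" for a b using assms by (simp add: graded_hom_def)
  show "\<Psi> (a * b) = tmul (\<Psi> a) (\<Psi> b)" using assms by (simp add: graded_hom_def)
  show "\<Psi> (Poly_Mapping.single 0 c) = Poly_Mapping.single 0 (\<iota> c)" using assms by (simp add: graded_hom_def)
  show "\<Psi> 0 = 0" using add[of 0 0] by (simp only: add_0_left add_cancel_right_right)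
  show "\<Psi> (a - b) = \<Psi> a - \<Psi> b" using add[of "a - b" b] by (simp add: algebra_simps)
qed

lemma graded_hom_sum:
  assumes "graded_hom \<Psi>"
  shows "\<Psi> (\<Sum>i\<in>A. g i) = (\<Sum>i\<in>A. \<Psi> (g i))"
  by (induction A rule: infinite_finite_induct) (simp_all add: graded_homD[OF assms])

lemma graded_hom_free_eval:
  assumes \<Psi>: "graded_hom \<Psi>" and z: "\<Psi> z = Poly_Mapping.single 0 t"
  shows "\<Psi> (free_eval f z) = Poly_Mapping.single 0 (\<Sum>i\<le>degree f. \<iota> (coeff f i) * t ^ i)"
proof -
  have one: "\<Psi> 1 = Poly_Mapping.single 0 1"
    using graded_homD(3)[OF \<Psi>, of 1] by (simp add: \<iota>_one)
  have "\<Psi> (z ^ i) = Poly_Mapping.single 0 (t ^ i)" for i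
    by (induction i) (simp_all add: graded_homD[OF \<Psi>] one z tmul_single_single \<sigma>_zero_exp)
  then have "\<Psi> (free_eval f z) = (\<Sum>i\<le>degree f. Poly_Mapping.single 0 (\<iota> (coeff f i) * t ^ i))"
    by (simp add: free_eval_def graded_hom_sum[OF \<Psi>] graded_homD[OF \<Psi>] tmul_single_single \<sigma>_zero_exp)
  also have "\<dots> = Poly_Mapping.single 0 (\<Sum>i\<le>degree f. \<iota> (coeff f i) * t ^ i)"
    by (rule poly_mapping_eqI) (simp add: lookup_sum lookup_single when_def)
  finally show ?thesis .
qed

text \<open>In the subalgebra generated by \<open>a x\<close>, \<open>b x\<^sup>-\<^sup>1\<close> and elements of degree zero, every
  coefficient of \<open>x\<^sup>n\<close> is a multiple of \<open>leading a b n\<close>.\<close>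

definition leading :: "'p \<Rightarrow> 'p \<Rightarrow> int \<Rightarrow> 'p"
  where "leading a b n = (if n \<ge> 0 then \<Prod>i<nat n. \<sigma> (int i) a else \<Prod>i<nat (- n). \<sigma> (- int i) b)"

lemma leading_int: "leading a b (int m) = (\<Prod>i<m. \<sigma> (int i) a)"
  by (simp add: leading_def)

lemma leading_minus_int: "leading a b (- int m) = (\<Prod>i<m. \<sigma> (- int i) b)"
  by (simp add: leading_def)

text \<open>For n \<ge> 1 both sides agree: shifting by \<open>\<sigma> 1\<close> and multiplying by
  \<open>a\<close> lengthens the product by one factor. For n \<le> 0 the shifted product is
  \<open>leading a b n\<close> times the surplus factor \<open>\<sigma> 1 b\<close>, so only
  divisibility remains.\<close>

lemma leading_up: "leading a b n dvd a * \<sigma> 1 (leading a b (n - 1))"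
proof (cases "n \<ge> 1")
  case True
  define m where "m = nat (n - 1)"
  have m: "n = int (Suc m)" "n - 1 = int m" using True by (simp_all add: m_def)
  show ?thesis unfolding m(2) unfolding m(1) leading_int
    by (simp only: prod.lessThan_Suc_shift \<sigma>_prod)
      (simp add: \<sigma>_\<sigma> \<sigma>_zero_exp)
next
  case False
  define m where "m = nat (- n)"
  have m: "n = - int m" "n - 1 = - int (Suc m)" using False by (simp_all add: m_def)
  show ?thesis unfolding m(2) unfolding m(1) leading_minus_int
    by (simp only: prod.lessThan_Suc_shift \<sigma>_prod \<sigma>_mult) (simp add: \<sigma>_\<sigma>)
qed

lemma leading_down: "leading a b n dvd b * \<sigma> (- 1) (leading a b (n + 1))"
proof (cases "n \<ge> 0")
  case True
  define m where "m = nat n"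
  have m: "n = int m" "n + 1 = int (Suc m)" using True by (simp_all add: m_def)
  show ?thesis unfolding m(2) unfolding m(1) leading_int
    by (simp only: prod.lessThan_Suc_shift \<sigma>_prod \<sigma>_mult) (simp add: \<sigma>_\<sigma>)
next
  case False
  define m where "m = nat (- n - 1)"
  have m: "n = - int (Suc m)" "n + 1 = - int m" using False by (simp_all add: m_def)
  show ?thesis unfolding m(2) unfolding m(1) leading_minus_int
    by (simp only: prod.lessThan_Suc_shift \<sigma>_prod) (simp add: \<sigma>_\<sigma> \<sigma>_zero_exp)
qed

text \<open>Left multiplication by a x carries the coefficient of degree n - 1, twisted and
  multiplied by \<open>a\<close>, to degree n, where \<open>leading_up\<close> applies; b x^(-1) is
  handled by \<open>leading_down\<close>, and h only multiplies within each degree. This is the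
  obstruction to lying in the image of a Smith algebra.\<close>

lemma leading_dvd_lookup:
  assumes \<Psi>: "graded_hom \<Psi>"
    and X: "\<Psi> (free_gen smith_gen.X) = Poly_Mapping.single 1 a"
    and Y: "\<Psi> (free_gen Y) = Poly_Mapping.single (- 1) b"
    and H: "\<Psi> (free_gen H) = Poly_Mapping.single 0 t"
  shows "leading a b n dvd Poly_Mapping.lookup (\<Psi> z) n"
proof (induction z arbitrary: n rule: free_algebra_induct)
  case (scalar c)
  show ?case by (auto simp: graded_homD[OF \<Psi>] lookup_single when_def leading_def)
next
  case (add u v)
  then show ?case by (simp add: graded_homD[OF \<Psi>] lookup_add dvd_add)
next
  case (gen g u)
  have mono: "\<sigma> i (leading a b m) dvd \<sigma> i (Poly_Mapping.lookup (\<Psi> u) m)" for i m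
    using gen[of m] by (metis \<sigma>_mult dvdE dvd_triv_left)
  show ?case
  proof (cases g)
    case X
    have "leading a b n dvd a * \<sigma> 1 (Poly_Mapping.lookup (\<Psi> u) (n - 1))"
      using leading_up mono[of 1 "n - 1"] by (meson dvd_trans mult_dvd_mono dvd_refl)
    then show ?thesis by (simp add: X graded_homD[OF \<Psi>] assms(2) lookup_tmul_single_left)
  next
    case Y
    have "leading a b n dvd b * \<sigma> (- 1) (Poly_Mapping.lookup (\<Psi> u) (n + 1))"
      using leading_down mono[of "- 1" "n + 1"] by (meson dvd_trans mult_dvd_mono dvd_refl)
    then show ?thesis by (simp add: Y graded_homD[OF \<Psi>] assms(3) lookup_tmul_single_left)
  next
    case H
    show ?thesis using gen[of n]
      by (simp add: H graded_homD[OF \<Psi>] assms(4) lookup_tmul_single_left \<sigma>_zero_exp)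
  qed
qed

section \<open>Evaluation of words at monomials\<close>

definition gen_degree :: "smith_gen \<Rightarrow> int"
  where "gen_degree g = (case g of smith_gen.X \<Rightarrow> 1 | Y \<Rightarrow> - 1 | H \<Rightarrow> 0)"

definition word_degree :: "smith_gen word \<Rightarrow> int"
  where "word_degree w = sum_list (map gen_degree (letters w))"

text \<open>If each letter g is sent to c(g) times x to its degree, a word is sent to
  \<open>word_coeff c w\<close> times x to the power \<open>word_degree w\<close>: moving x to the
  right twists the coefficients of the later letters.\<close>

definition word_coeff :: "(smith_gen \<Rightarrow> 'p) \<Rightarrow> smith_gen word \<Rightarrow> 'p"
  where "word_coeff c w = foldr (\<lambda>g u. c g * \<sigma> (gen_degree g) u) (letters w) 1"

lemma word_coeff_plus: "word_coeff c (v + w) = word_coeff c v * \<sigma> (word_degree v) (word_coeff c w)"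
proof -
  have "foldr (\<lambda>g u. c g * \<sigma> (gen_degree g) u) ls u
      = foldr (\<lambda>g u. c g * \<sigma> (gen_degree g) u) ls 1 * \<sigma> (sum_list (map gen_degree ls)) u" for ls u
    by (induction ls) (simp_all add: \<sigma>_zero_exp \<sigma>_mult \<sigma>_\<sigma> mult.assoc)
  from this[where ls = "letters v" and u = "word_coeff c w"] show ?thesis
    by (simp add: word_coeff_def word_degree_def plus_word_def)
qed

definition laurent_eval :: "(smith_gen \<Rightarrow> 'p) \<Rightarrow> (smith_gen word \<Rightarrow>\<^sub>0 'k) \<Rightarrow> (int \<Rightarrow>\<^sub>0 'p)"
  where "laurent_eval c z = (\<Sum>w\<in>Poly_Mapping.keys z.
    Poly_Mapping.single (word_degree w) (\<iota> (Poly_Mapping.lookup z w) * word_coeff c w))"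

lemma laurent_eval_single:
  "laurent_eval c (Poly_Mapping.single w v) = Poly_Mapping.single (word_degree w) (\<iota> v * word_coeff c w)"
  by (simp add: laurent_eval_def \<iota>_zero)

lemma laurent_eval_add: "laurent_eval c (y + z) = laurent_eval c y + laurent_eval c z"
  unfolding laurent_eval_def
  by (rule setsum_keys_plus_distrib) (simp_all add: \<iota>_zero \<iota>_add algebra_simps single_add)

lemma laurent_eval_gen: "laurent_eval c (free_gen g) = Poly_Mapping.single (gen_degree g) (c g)"
  by (simp add: free_gen_def laurent_eval_single word_degree_def word_coeff_def \<iota>_one \<sigma>_one)

lemma graded_hom_laurent_eval: "graded_hom (laurent_eval c)"
  unfolding graded_hom_def
proof (intro conjI allI)
  fix y z :: "smith_gen word \<Rightarrow>\<^sub>0 'k"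
  show "laurent_eval c (y * z) = tmul (laurent_eval c y) (laurent_eval c z)"
  proof (induction y rule: poly_mapping_add_induct)
    case (single v d)
    show ?case
    proof (induction z rule: poly_mapping_add_induct)
      case (single w e)
      have "word_degree (v + w) = word_degree v + word_degree w"
        by (simp add: word_degree_def plus_word_def)
      then show ?case
        by (simp add: mult_single laurent_eval_single tmul_single_single word_coeff_plus \<iota>_mult \<sigma>_mult \<sigma>_\<iota> ac_simps)
    qed (simp add: laurent_eval_add distrib_left tmul_add_right)
  qed (simp add: laurent_eval_add distrib_right tmul_add_left)
qed (simp_all add: laurent_eval_add laurent_eval_single word_degree_def word_coeff_def zero_word_def)

text \<open>The kernel is an ideal, so the three relators suffice; their images are concentrated in
  degrees 1, -1 and 0, and the equations \<open>t\<close> and \<open>f\<close> make them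
  vanish.\<close>

lemma graded_hom_smith_ideal:
  assumes \<Psi>: "graded_hom \<Psi>"
    and X: "\<Psi> (free_gen smith_gen.X) = Poly_Mapping.single 1 a"
    and Y: "\<Psi> (free_gen Y) = Poly_Mapping.single (- 1) b"
    and H: "\<Psi> (free_gen H) = Poly_Mapping.single 0 t"
    and t: "\<sigma> 1 t = \<iota> q * t" "t = \<iota> q * \<sigma> (- 1) t"
    and f: "a * \<sigma> 1 b - b * \<sigma> (- 1) a = (\<Sum>i\<le>degree f. \<iota> (coeff f i) * t ^ i)"
    and z: "z \<in> smith_ideal q f"
  shows "\<Psi> z = 0"
proof -
  note hom = graded_homD[OF \<Psi>]
  have tmul0: "tmul 0 u = 0" "tmul u 0 = 0" for u by (simp_all add: tmul_def)
  have "smith_ideal q f \<subseteq> {z. \<Psi> z = 0}"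
  proof (rule smith_ideal_least)
    show "ideal {z. \<Psi> z = 0} free_algebra"
      by (rule ideal_free_algebraI) (simp_all add: hom tmul0)
    have "\<Psi> (free_gen smith_gen.X * free_gen H - Poly_Mapping.single 0 q * free_gen H * free_gen smith_gen.X) = 0"
      by (simp add: hom X H tmul_single_single t(1) \<sigma>_zero_exp algebra_simps)
    moreover have "\<Psi> (free_gen H * free_gen Y - Poly_Mapping.single 0 q * free_gen Y * free_gen H) = 0"
    proof -
      have "t * b = \<iota> q * b * \<sigma> (- 1) t" using arg_cong[OF t(2), of "\<lambda>u. u * b"] by (simp add: ac_simps)
      show ?thesis by (simp add: hom Y H tmul_single_single \<sigma>_zero_exp \<open>t * b = _\<close>)
    qed
    moreover have "\<Psi> (free_gen smith_gen.X * free_gen Y - free_gen Y * free_gen smith_gen.X - free_eval f (free_gen H)) = 0"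
      by (simp add: hom X Y graded_hom_free_eval[OF \<Psi> H] tmul_single_single flip: f)
        (simp flip: single_diff)
    ultimately show "smith_relators q f \<subseteq> {z. \<Psi> z = 0}"
      by (auto simp: smith_relators_def Let_def)
  qed
  with z show ?thesis by blast
qed

end

section \<open>Commutators in the Smith algebra\<close>

text \<open>The element h is normal: modulo the relations xh = q hx and yh = q^(-1) hy. Hence left
  multiplication by a generator preserves the right ideal generated by h.\<close>

lemma smith_normal_left:
  fixes q :: "'k::field"
  assumes "q \<noteq> 0" and "z - free_gen H * u \<in> smith_ideal q f"
  shows "\<exists>v. r * z - free_gen H * v \<in> smith_ideal q f"
proof (induction r rule: free_algebra_induct)
  case (scalar c)
  have "Poly_Mapping.single 0 c * z - free_gen H * (Poly_Mapping.single 0 c * u)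
      = Poly_Mapping.single 0 c * (z - free_gen H * u)"
    by (simp add: mult_scalar_left[of "free_gen H"] algebra_simps)
  then show ?case using smith_ideal_closed(3)[OF assms(2)] by metis
next
  case (add a b)
  then obtain v w where "a * z - free_gen H * v \<in> smith_ideal q f" "b * z - free_gen H * w \<in> smith_ideal q f"
    by auto
  from smith_ideal_closed(2)[OF this] show ?case
    by (intro exI[of _ "v + w"]) (simp add: algebra_simps)
next
  case (gen g a)
  then obtain v where v: "a * z - free_gen H * v \<in> smith_ideal q f" by auto
  show ?case
  proof (cases g)
    case X
    have "free_gen smith_gen.X * a * z - free_gen H * (Poly_Mapping.single 0 q * free_gen smith_gen.X * v)
      = free_gen smith_gen.X * (a * z - free_gen H * v)
        + (free_gen smith_gen.X * free_gen H - Poly_Mapping.single 0 q * free_gen H * free_gen smith_gen.X) * v"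
      by (simp add: mult_scalar_left[of "free_gen H"] algebra_simps)
    moreover have "\<dots> \<in> smith_ideal q f"
      by (intro smith_ideal_closed(2) smith_ideal_closed(3)[OF v] smith_ideal_closed(4) smith_relator_mem)
    ultimately show ?thesis unfolding X by metis
  next
    case Y
    \<comment> \<open>The relation hy = q yh is solved for yh, which produces the factor q^(-1) in
      the cofactor and in front of the relator.\<close>
    have "free_gen Y * a * z - free_gen H * (Poly_Mapping.single 0 (inverse q) * free_gen Y * v)
      = free_gen Y * (a * z - free_gen H * v)
        + Poly_Mapping.single 0 (- inverse q) * ((free_gen H * free_gen Y - Poly_Mapping.single 0 q * free_gen Y * free_gen H) * v)"
      using \<open>q \<noteq> 0\<close>
      by (simp add: mult_scalar_left[of "free_gen H"] algebra_simps single_uminus)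
        (simp add: mult_single flip: mult.assoc)
    moreover have "\<dots> \<in> smith_ideal q f"
      by (rule smith_ideal_closed(2)[OF smith_ideal_closed(3)[OF v]
            smith_ideal_closed(3)[OF smith_ideal_closed(4)[OF smith_relator_mem(2)]]])
    ultimately show ?thesis unfolding Y by metis
  next
    case H
    show ?thesis unfolding H
      by (rule exI[of _ "a * z"]) (simp add: mult.assoc smith_ideal_closed)
  qed
qed

text \<open>Modulo h the generators commute; for x and y this is because f(0) = 0 makes f(h) a
  multiple of h. Since h is normal, the quotient by h is a commutative ring.\<close>

lemma smith_commutator:
  fixes q :: "'k::field"
  assumes "q \<noteq> 0" and f0: "poly f 0 = 0"
  shows "\<exists>u. (r * s - s * r) - free_gen H * u \<in> smith_ideal q f"
proof -
  let ?x = "free_gen smith_gen.X :: smith_gen word \<Rightarrow>\<^sub>0 'k" and ?y = "free_gen Y :: smith_gen word \<Rightarrow>\<^sub>0 'k"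
    and ?h = "free_gen H :: smith_gen word \<Rightarrow>\<^sub>0 'k"
  \<comment> \<open>The preimage in the free algebra of the ideal generated by h.\<close>
  define J where "J = {z. \<exists>u. z - ?h * u \<in> smith_ideal q f}"
  have J_left: "a * z \<in> J" if "z \<in> J" for a z
    using that smith_normal_left[OF \<open>q \<noteq> 0\<close>] by (auto simp: J_def)
  have J_right: "z * a \<in> J" if "z \<in> J" for a z
  proof -
    from that obtain u where "z - ?h * u \<in> smith_ideal q f" by (auto simp: J_def)
    from smith_ideal_closed(4)[OF this, of a] show ?thesis
      by (auto simp: J_def algebra_simps)
  qed
  have J_add: "a + b \<in> J" if "a \<in> J" "b \<in> J" for a b
  proof -
    from that obtain u v where "a - ?h * u \<in> smith_ideal q f" "b - ?h * v \<in> smith_ideal q f"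
      by (auto simp: J_def)
    from smith_ideal_closed(2)[OF this] show ?thesis
      by (auto simp: J_def algebra_simps intro!: exI[of _ "u + v"])
  qed
  have J_minus: "- a \<in> J" if "a \<in> J" for a using J_left[OF that, of "- 1"] by simp
  have J_mem: "z \<in> J" if "z - ?h * u \<in> smith_ideal q f" for z u using that by (auto simp: J_def)
  have J0: "0 \<in> J" using smith_ideal_closed(1)[of q f] by (auto simp: J_def intro!: exI[of _ 0])
  have xh: "?x * ?h - ?h * ?x \<in> J"
    by (rule J_mem[of _ "Poly_Mapping.single 0 q * ?x - ?x"])
      (use smith_relator_mem(1)[of q f] in \<open>simp add: mult_scalar_left[of ?h] algebra_simps\<close>)
  have hy: "?h * ?y - ?y * ?h \<in> J"
  proof (rule J_mem[of _ "?y - Poly_Mapping.single 0 (inverse q) * ?y"])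
    have "?h * ?y - ?y * ?h - ?h * (?y - Poly_Mapping.single 0 (inverse q) * ?y)
      = Poly_Mapping.single 0 (inverse q) * (?h * ?y - Poly_Mapping.single 0 q * ?y * ?h)"
      using \<open>q \<noteq> 0\<close>
      by (simp add: mult_scalar_left[of ?h] algebra_simps) (simp add: mult_single flip: mult.assoc)
    also have "\<dots> \<in> smith_ideal q f" by (rule smith_ideal_closed(3)[OF smith_relator_mem(2)])
    finally show "?h * ?y - ?y * ?h - ?h * (?y - Poly_Mapping.single 0 (inverse q) * ?y) \<in> smith_ideal q f" .
  qed
  have xy: "?x * ?y - ?y * ?x \<in> J"
  proof (rule J_mem)
    have "free_eval f ?h = ?h * (\<Sum>i<degree f. Poly_Mapping.single 0 (coeff f (Suc i)) * ?h ^ i)"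
      using f0 by (simp add: free_eval_def sum.atMost_shift poly_0_coeff_0 sum_distrib_left mult_scalar_left[of ?h])
    then show "?x * ?y - ?y * ?x - ?h * (\<Sum>i<degree f. Poly_Mapping.single 0 (coeff f (Suc i)) * ?h ^ i) \<in> smith_ideal q f"
      using smith_relator_mem(3)[of f q] by simp
  qed
  have gens: "free_gen g * free_gen g' - free_gen g' * free_gen g \<in> J" for g g'
    using xh hy xy J_minus[OF xh] J_minus[OF hy] J_minus[OF xy] J0
    by (cases g; cases g') simp_all
  \<comment> \<open>Leibniz rule in the second argument: [g, g'a] = g'[g, a] + [g, g']a.\<close>
  have gen: "free_gen g * s - s * free_gen g \<in> J" for g s
  proof (induction s rule: free_algebra_induct)
    case (scalar c)
    then show ?case using J0 by (simp add: scalar_central)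
  next
    case (add a b)
    from J_add[OF this] show ?case by (simp add: algebra_simps)
  next
    case (gen g' a)
    from J_add[OF J_left[OF gen, of "free_gen g'"] J_right[OF gens[of g g'], of a]]
    show ?case by (simp add: algebra_simps)
  qed
  \<comment> \<open>Leibniz rule in the first argument: [g'a, s] = g'[a, s] + [g', s]a.\<close>
  have "r * s - s * r \<in> J" for s
  proof (induction r rule: free_algebra_induct)
    case (scalar c)
    then show ?case using J0 by (simp add: scalar_central)
  next
    case (add a b)
    from J_add[OF this] show ?case by (simp add: algebra_simps)
  next
    case (gen g' a)
    from J_add[OF J_left[OF gen, of "free_gen g'"] J_right[OF \<open>\<And>g s. free_gen g * s - s * free_gen g \<in> J\<close>[of g' s], of a]]
    show ?case by (simp add: algebra_simps)
  qed
  then show ?thesis by (auto simp: J_def)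
qed

section \<open>Twisted Laurent polynomials over two commuting variables\<close>

text \<open>The inner variable stands for the central element \<open>\<Omega> = yx - a(h)\<close>, the outer one for \<open>h\<close>;
  \<open>twist q i\<close> is conjugation by \<open>x\<^sup>i\<close>.\<close>

definition twist :: "'k::field \<Rightarrow> int \<Rightarrow> 'k poly poly \<Rightarrow> 'k poly poly"
  where "twist q i p = pcompose p [:0, [:q powi i:]:]"

lemma coeff_twist: "coeff (twist q i p) n = [:(q powi i) ^ n:] * coeff p n"
  by (simp add: twist_def coeff_pcompose_linear poly_const_pow)

lemma twisted_laurent_twist:
  assumes "q \<noteq> 0"
  shows "twisted_laurent (twist q) (\<lambda>c. [:[:c:]:])"
proof
  show "twist q i (twist q j a) = twist q (i + j) a" for i j a
    by (rule poly_eqI) (simp add: coeff_twist power_int_add assms power_mult_distrib mult.commute)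
  show "twist q 0 a = a" for a
    by (rule poly_eqI) (simp add: coeff_twist)
qed (simp_all add: twist_def pcompose_add pcompose_mult pcompose_1 flip: one_pCons)

text \<open>The element \<open>\<Omega> + a(h) = yx\<close>, so that \<open>y\<close> is sent to \<open>casimir_shift a x\<^sup>-\<^sup>1\<close>.\<close>

definition casimir_shift :: "'k::field poly \<Rightarrow> 'k poly poly"
  where "casimir_shift a = [:[:0, 1:]:] + map_poly (\<lambda>c. [:c:]) a"

lemma coeff_casimir_shift: "coeff (casimir_shift a) n = (if n = 0 then [:coeff a 0, 1:] else [:coeff a n:])"
  by (simp add: casimir_shift_def coeff_map_poly coeff_pCons split: nat.split)

text \<open>The sum is f(\<beta>h) in k[\<Omega>][h]; its coefficients are free of \<Omega>.\<close>

lemma coeff_eval_linear: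
  "coeff (\<Sum>i\<le>degree f. [:[:coeff f i:]:] * [:0, [:\<beta>:]:] ^ i) n = [:coeff f n * \<beta> ^ n:]"
  for \<beta> :: "'k::field"
proof -
  have pw: "[:0, [:\<beta>:]:] ^ i = monom [:\<beta> ^ i:] i" for i
  proof -
    have "[:0, [:\<beta>:]:] = monom [:\<beta>:] 1" by (simp add: monom_Suc monom_0)
    then show ?thesis by (simp add: monom_power poly_const_pow)
  qed
  have "coeff (\<Sum>i\<le>degree f. [:[:coeff f i:]:] * [:0, [:\<beta>:]:] ^ i) n
      = (\<Sum>i\<le>degree f. if i = n then [:coeff f n * \<beta> ^ n:] else 0)"
    unfolding coeff_sum pw by (rule sum.cong) (auto)
  also have "\<dots> = [:coeff f n * \<beta> ^ n:]"
    by (auto simp: coeff_eq_0)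
  finally show ?thesis .
qed

text \<open>Degrees add over a domain, so one of the two factors of the variable is constant;
  comparing linear coefficients makes \<open>c\<close> a unit.\<close>

lemma dvd_linear_cases:
  fixes p :: "'a::idom poly"
  assumes "p dvd [:0, 1:]"
  obtains c where "p = [:c:]" "c dvd 1" | c where "p = [:0, c:]" "c dvd 1"
proof -
  from assms obtain r where r: "[:0, 1:] = p * r" by (rule dvdE)
  then have "p \<noteq> 0" "r \<noteq> 0" by auto
  then have "degree p + degree r = 1" using arg_cong[OF r, of degree] by (simp add: degree_mult_eq)
  then consider "degree p = 0" | "degree r = 0" by linarith
  then show ?thesis
  proof cases
    case 1
    then obtain c where c: "p = [:c:]" by (rule degree_eq_zeroE)
    have "1 = c * coeff r 1" using arg_cong[OF r, of "\<lambda>p. coeff p 1"] by (simp add: c)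
    then show ?thesis using that(1)[OF c] by (metis dvdI)
  next
    case 2
    then obtain d where d: "r = [:d:]" by (rule degree_eq_zeroE)
    have "[:0, 1:] = smult d p" using r by (simp add: d)
    then have cf: "coeff [:0, 1:] n = d * coeff p n" for n by (metis coeff_smult)
    have "d \<noteq> 0" using \<open>r \<noteq> 0\<close> d by auto
    have "p = [:0, coeff p 1:]"
    proof (rule poly_eqI)
      fix n
      show "coeff p n = coeff [:0, coeff p 1:] n"
        using cf[of n] \<open>d \<noteq> 0\<close> by (auto simp: coeff_pCons split: nat.splits)
    qed
    moreover have "coeff p 1 dvd 1" using cf[of 1] by (metis coeff_pCons_0 coeff_pCons_Suc One_nat_def dvd_triv_right)
    ultimately show ?thesis using that(2) by blast
  qed
qed

lemma unit_const_polyE: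
  fixes c :: "'k::field poly"
  assumes "c dvd 1"
  obtains b where "c = [:b:]" "b \<noteq> 0"
  using assms that by (cases "c = 0") (auto simp: is_unit_poly_iff)

lemma power_int_eq_1_imp:
  fixes q :: "'k::field"
  assumes "\<forall>n>0. q ^ n \<noteq> 1" "q powi n = 1"
  shows "n = 0"
proof (rule ccontr)
  assume "n \<noteq> 0"
  then have "q ^ nat \<bar>n\<bar> = 1" using assms(2) by (auto simp: power_int_def power_inverse split: if_splits)
  with assms(1) \<open>n \<noteq> 0\<close> show False by simp
qed

section \<open>Rigidity of epimorphisms between Smith algebras\<close>

text \<open>The values are coefficients only; \<open>gen_degree\<close> supplies the powers 1, -1
  and 0 of x that go with them.\<close>

definition smith_coords :: "'k::field poly \<Rightarrow> smith_gen \<Rightarrow> 'k poly poly"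
  where "smith_coords a g = (case g of smith_gen.X \<Rightarrow> 1 | Y \<Rightarrow> casimir_shift a | H \<Rightarrow> [:0, 1:])"

abbreviation "smith_laurent q a \<equiv>
  twisted_laurent.laurent_eval (twist q) (\<lambda>c. [:[:c:]:]) (smith_coords a)"

text \<open>A divisor of h is a unit or a unit multiple of h. The twisted element has \<Omega> +
  a(0) as its constant term in h, which is neither a unit of k[\<Omega>] nor zero.\<close>

lemma casimir_shift_not_dvd: "\<not> twist q i (casimir_shift a) dvd [:0, 1:]"
proof
  assume "twist q i (casimir_shift a) dvd [:0, 1:]"
  then show False
  proof (cases rule: dvd_linear_cases)
    case (1 c)
    have "c = [:coeff a 0, 1:]"
      using arg_cong[OF 1(1), of "\<lambda>p. coeff p 0"] by (simp add: coeff_twist coeff_casimir_shift)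
    with 1(2) show False by (auto elim!: unit_const_polyE)
  next
    case (2 c)
    have "[:coeff a 0, 1:] = 0"
      using arg_cong[OF 2(1), of "\<lambda>p. coeff p 0"] by (simp add: coeff_twist coeff_casimir_shift)
    then show False by simp
  qed
qed

text \<open>By \<open>ker\<close> and \<open>range\<close>, \<Psi> represents an epimorphism from
  R(f1) onto the image of R(f2) in the skew Laurent ring. The conclusion is f1(\<beta>h) =
  \<kappa>(a2(qh) - a2(h)) in coefficients; \<beta> is the factor of h and \<kappa> the product of
  the factors of x and y.\<close>

lemma smith_epi_coeffs:
  fixes q :: "'k::field" and f1 a2 :: "'k poly"
    and \<Psi> :: "(smith_gen word \<Rightarrow>\<^sub>0 'k) \<Rightarrow> (int \<Rightarrow>\<^sub>0 'k poly poly)"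
  assumes q: "q \<noteq> 0" "\<forall>n>0. q ^ n \<noteq> 1" and f1: "poly f1 0 = 0"
    and \<Psi>: "twisted_laurent.graded_hom (twist q) (\<lambda>c. [:[:c:]:]) \<Psi>"
    and ker: "\<And>z. z \<in> smith_ideal q f1 \<Longrightarrow> \<Psi> z = 0"
    and range: "range \<Psi> = range (smith_laurent q a2)"
  shows "\<exists>\<beta> \<kappa>. \<beta> \<noteq> 0 \<and> \<kappa> \<noteq> 0 \<and> (\<forall>n. coeff f1 n * \<beta> ^ n = \<kappa> * ((q ^ n - 1) * coeff a2 n))"
proof -
  interpret twisted_laurent "twist q" "\<lambda>c. [:[:c:]:]" by (rule twisted_laurent_twist[OF q(1)])
  define N where "N = smith_laurent q a2"
  define \<omega> where "\<omega> = casimir_shift a2"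
  define t :: "'k poly poly" where "t = [:0, 1:]"
  let ?x = "free_gen smith_gen.X :: smith_gen word \<Rightarrow>\<^sub>0 'k" and ?y = "free_gen Y :: smith_gen word \<Rightarrow>\<^sub>0 'k"
    and ?h = "free_gen H :: smith_gen word \<Rightarrow>\<^sub>0 'k"
  note hom = graded_homD[OF \<Psi>]
  have N: "graded_hom N" unfolding N_def by (rule graded_hom_laurent_eval)
  note homN = graded_homD[OF N]
  have Nx: "N ?x = Poly_Mapping.single 1 1" and Ny: "N ?y = Poly_Mapping.single (- 1) \<omega>"
    and Nh: "N ?h = Poly_Mapping.single 0 t"
    by (simp_all add: N_def laurent_eval_gen gen_degree_def smith_coords_def \<omega>_def t_def)
  have lift: "\<exists>z. \<Psi> z = N w" for w
  proof -
    have "N w \<in> range \<Psi>" unfolding range N_def by simp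
    then show ?thesis by auto
  qed
  have lower: "\<exists>w. \<Psi> z = N w" for z
  proof -
    have "\<Psi> z \<in> range N" unfolding N_def range[symmetric] by simp
    then show ?thesis by auto
  qed
  \<comment> \<open>For negative n this forces a product of -n twists of \<omega> into every
    coefficient of x^n; for n \<ge> 0 it is no constraint.\<close>
  have lead: "leading 1 \<omega> n dvd Poly_Mapping.lookup (\<Psi> z) n" for n z
    using lower[of z] leading_dvd_lookup[OF N Nx Ny Nh] by metis
  have q1: "q \<noteq> 1" using q(2)[rule_format, of 1] by simp
  have t0: "t \<noteq> 0" by (simp add: t_def)
  have \<omega>0: "\<omega> \<noteq> 0" unfolding \<omega>_def
    using casimir_shift_not_dvd[of q 0 a2] coeff_casimir_shift[of a2 0] by auto
  have twist_t: "twist q i [:0, c:] = [:[:q powi i:]:] * [:0, c:]" for i c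
    by (rule poly_eqI) (simp add: coeff_twist coeff_pCons split: nat.splits)
  have const: "[:[:c:]:] * [:[:d:]:] = [:[:c * d:]:]" for c d :: 'k by simp

  define g where "g = \<Psi> ?h"
  have commutator: "\<exists>u. \<Psi> (r * s - s * r) = tmul g (\<Psi> u)" for r s
  proof -
    obtain u where "(r * s - s * r) - ?h * u \<in> smith_ideal q f1"
      using smith_commutator[OF q(1) f1] by blast
    from ker[OF this] show ?thesis by (intro exI[of _ u]) (simp add: hom g_def)
  qed
  \<comment> \<open>The scalars normalise the commutators: since [x, h] = (q - 1)hx and [h, y] = (1
    - 1/q)hy, the elements x/(q - 1) and y/(1 - 1/q) give exactly hx and hy.\<close>
  obtain \<xi> where \<xi>: "\<Psi> \<xi> = Poly_Mapping.single 1 [:[:1 / (q - 1):]:]"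
    using lift[of "Poly_Mapping.single 0 (1 / (q - 1)) * ?x"] by (auto simp: homN Nx tmul_single_single \<sigma>_one)
  obtain \<upsilon> where \<upsilon>: "\<Psi> \<upsilon> = Poly_Mapping.single (- 1) ([:[:1 / (1 - 1 / q):]:] * \<omega>)"
    using lift[of "Poly_Mapping.single 0 (1 / (1 - 1 / q)) * ?y"]
    by (auto simp: homN Ny tmul_single_single \<sigma>_zero_exp)
  obtain \<eta> where \<eta>: "\<Psi> \<eta> = Poly_Mapping.single 0 t" using lift[of ?h] by (auto simp: Nh)
  have "\<Psi> (\<xi> * \<eta> - \<eta> * \<xi>) = Poly_Mapping.single 1 t"
  proof -
    have "[:[:1 / (q - 1):]:] * ([:[:q:]:] * t) - t * [:[:1 / (q - 1):]:] = [:[:1 / (q - 1):]:] * [:[:q - 1:]:] * t"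
    proof -
      have *: "[:[:q - 1:]:] = [:[:q:]:] - 1" by (simp add: one_pCons)
      show ?thesis unfolding * by (simp only: algebra_simps mult_1_left mult_1_right)
    qed
    also have "\<dots> = t" using q1 by (simp add: const del: mult_pCons_left flip: one_pCons)
    finally show ?thesis
      by (simp add: hom \<xi> \<eta> tmul_single_single \<sigma>_zero_exp twist_t[of 1 1, folded t_def] flip: single_diff del: mult_pCons_left mult_pCons_right)
  qed
  with commutator obtain u where "tmul g (\<Psi> u) = Poly_Mapping.single 1 t" by metis
  \<comment> \<open>As a left factor of the monomial hx, g is itself a monomial, and its coefficient
    divides h.\<close>
  from factors_homogeneous[OF this t0] obtain i \<gamma> a where
    g: "g = Poly_Mapping.single i \<gamma>" and a: "t = \<gamma> * twist q i a" by metis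
  have "\<Psi> (\<eta> * \<upsilon> - \<upsilon> * \<eta>) = Poly_Mapping.single (- 1) (t * \<omega>)"
  proof -
    let ?c = "1 / (1 - 1 / q)"
    have "t * ([:[:?c:]:] * \<omega>) - ([:[:?c:]:] * \<omega>) * ([:[:1 / q:]:] * t) = [:[:?c:]:] * [:[:1 - 1 / q:]:] * (t * \<omega>)"
    proof -
      have *: "[:[:1 - 1 / q:]:] = 1 - [:[:1 / q:]:]" by (simp add: one_pCons)
      show ?thesis unfolding * by (simp only: algebra_simps mult_1_left mult_1_right)
    qed
    also have "\<dots> = t * \<omega>" using q q1 by (simp add: const field_simps del: mult_pCons_left flip: one_pCons)
    finally show ?thesis using twist_t[of "- 1" 1, folded t_def]
      by (simp add: hom \<upsilon> \<eta> tmul_single_single \<sigma>_zero_exp power_int_minus inverse_eq_divide flip: single_diff del: mult_pCons_left mult_pCons_right)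
  qed
  with commutator obtain v where v: "tmul g (\<Psi> v) = Poly_Mapping.single (- 1) (t * \<omega>)" by metis
  have "t * \<omega> \<noteq> 0" using t0 \<omega>0 by simp
  from factors_homogeneous[OF v this] obtain i' \<gamma>' b where
    g': "g = Poly_Mapping.single i' \<gamma>'" and b': "\<Psi> v = Poly_Mapping.single (- 1 - i') b" "t * \<omega> = \<gamma>' * twist q i' b"
    by metis
  have \<gamma>0: "\<gamma> \<noteq> 0" using a t0 by auto
  have ii: "i' = i" "\<gamma>' = \<gamma>"
    using g g' \<gamma>0 by (metis lookup_single_eq lookup_single_not_eq)+
  note b = b'[unfolded ii]
  have not_dvd: "\<not> twist q j \<omega> dvd t" for j unfolding \<omega>_def t_def by (rule casimir_shift_not_dvd)

  have "i = 0"
  proof (rule ccontr)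
    assume "i \<noteq> 0"
    then consider m where "i = int (Suc m)" | m where "i = - int (Suc m)"
      by (metis int_cases2 not0_implies_Suc of_nat_0 neg_0_equal_iff_equal)
    then show False
    proof cases
      case (1 m)
      \<comment> \<open>For i > 0 the cofactor of g in hy has degree -1 - i, hence carries i + 1
        twists of \<omega>. After twisting by i, the last of them is \<omega> itself, which cancels
        against hy; the first remains and would divide h.\<close>
      have "leading 1 \<omega> (- 1 - i) dvd b" using lead[of "- 1 - i" v] by (simp add: b)
      moreover have "leading 1 \<omega> (- 1 - i) = (\<Prod>j<Suc (Suc m). twist q (- int j) \<omega>)"
        using leading_minus_int[of 1 \<omega> "Suc (Suc m)"] 1 by (simp add: algebra_simps)
      ultimately obtain c where "b = (\<Prod>j<Suc (Suc m). twist q (- int j) \<omega>) * c" by (metis dvdE)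
      then have "twist q i b = (\<Prod>j<Suc (Suc m). twist q (i - int j) \<omega>) * twist q i c"
        by (simp only: \<sigma>_mult \<sigma>_prod \<sigma>_\<sigma> diff_conv_add_uminus)
      also have "\<dots> = twist q i \<omega> * (\<Prod>j<m. twist q (i - int (Suc j)) \<omega>) * \<omega> * twist q i c"
        using 1 by (simp add: prod.lessThan_Suc_shift[of _ m] prod.lessThan_Suc[of _ "Suc m"] \<sigma>_zero_exp del: prod.lessThan_Suc)
      finally have "t * \<omega> = twist q i \<omega> * (\<gamma> * (\<Prod>j<m. twist q (i - int (Suc j)) \<omega>) * twist q i c) * \<omega>"
        using b(2) by (simp only: ac_simps)
      then have "t = twist q i \<omega> * (\<gamma> * (\<Prod>j<m. twist q (i - int (Suc j)) \<omega>) * twist q i c)"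
        using \<omega>0 by (metis mult_right_cancel)
      then show False using not_dvd[of i] by (metis dvd_triv_left)
    next
      case (2 m)
      \<comment> \<open>For i < 0 already the coefficient of g contains \<omega>, although it
        divides h.\<close>
      have "leading 1 \<omega> i dvd \<gamma>" using lead[of i ?h] g by (simp add: g_def)
      then have "twist q 0 \<omega> dvd \<gamma>" unfolding 2 leading_minus_int prod.lessThan_Suc_shift
        by (metis dvd_mult_left minus_zero of_nat_0)
      then show False using not_dvd[of 0] a by (metis dvd_mult2)
    qed
  qed
  note g = g[unfolded \<open>i = 0\<close>]
  have "\<gamma> dvd [:0, 1:]" using a unfolding t_def by (metis dvd_triv_left)
  define xs where "xs = \<Psi> ?x"
  define ys where "ys = \<Psi> ?y"
  have "tmul xs g - tmul (tmul (Poly_Mapping.single 0 [:[:q:]:]) g) xs = 0"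
    using ker[OF smith_relator_mem(1)] by (simp add: hom xs_def g_def)
  then have "Poly_Mapping.lookup (tmul xs g - tmul (tmul (Poly_Mapping.single 0 [:[:q:]:]) g) xs) n = 0" for n
    by simp
  \<comment> \<open>The images of x and y may still be inhomogeneous, so the relations with h are
    read off in every degree.\<close>
  then have xs: "Poly_Mapping.lookup xs n * twist q n \<gamma> = [:[:q:]:] * \<gamma> * Poly_Mapping.lookup xs n" for n
    by (simp add: g tmul_single_single lookup_minus lookup_tmul_single_left lookup_tmul_single_right \<sigma>_zero_exp
        del: mult_pCons_left mult_pCons_right)
  have "tmul g ys - tmul (tmul (Poly_Mapping.single 0 [:[:q:]:]) ys) g = 0"
    using ker[OF smith_relator_mem(2)] by (simp add: hom ys_def g_def)
  then have "Poly_Mapping.lookup (tmul g ys - tmul (tmul (Poly_Mapping.single 0 [:[:q:]:]) ys) g) n = 0" for n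
    by simp
  then have ys: "\<gamma> * Poly_Mapping.lookup ys n = [:[:q:]:] * Poly_Mapping.lookup ys n * twist q n \<gamma>" for n
    by (simp add: g lookup_minus lookup_tmul_single_left lookup_tmul_single_right \<sigma>_zero_exp
        del: mult_pCons_left mult_pCons_right)
  obtain z where z: "\<Psi> z = Poly_Mapping.single 1 1" using lift[of ?x] by (auto simp: Nx)
  from \<open>\<gamma> dvd [:0, 1:]\<close> obtain \<beta> where \<beta>: "\<beta> \<noteq> 0" "\<gamma> = [:[:\<beta>:]:] \<or> \<gamma> = [:0, [:\<beta>:]:]"
    by (auto elim!: dvd_linear_cases unit_const_polyE)
  \<comment> \<open>A scalar would be fixed by every twist; as q \<noteq> 1, the relations would
    then kill the images of x and y.\<close>
  have \<gamma>: "\<gamma> = [:0, [:\<beta>:]:]"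
  proof (rule ccontr)
    assume "\<gamma> \<noteq> [:0, [:\<beta>:]:]"
    then have \<gamma>: "\<gamma> = [:[:\<beta>:]:]" using \<beta> by simp
    have cancel: "w = 0" if "w * \<gamma> = [:[:q:]:] * \<gamma> * w" for w
    proof -
      have "(1 - [:[:q:]:]) * (\<gamma> * w) = w * \<gamma> - [:[:q:]:] * \<gamma> * w"
        by (simp only: algebra_simps mult_1_left)
      then have "(1 - [:[:q:]:]) * (\<gamma> * w) = 0" by (simp only: that diff_self)
      moreover have "1 - [:[:q:]:] \<noteq> (0 :: 'k poly poly)" using q1 by (simp add: one_pCons)
      ultimately show ?thesis using \<gamma>0 by simp
    qed
    have "twist q n \<gamma> = \<gamma>" for n unfolding \<gamma> by (rule \<sigma>_\<iota>)
    then have "Poly_Mapping.lookup xs n = 0" "Poly_Mapping.lookup ys n = 0" for n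
      using xs[of n] ys[of n] by (auto intro!: cancel simp only: ac_simps)
    \<comment> \<open>Zero is written as a monomial of degree 1 and of degree -1, so that the
      divisibility bound applies with both coefficients 0; it would make 0 divide the coefficient 1
      of x.\<close>
    then have "xs = Poly_Mapping.single 1 0" "ys = Poly_Mapping.single (- 1) 0"
      by (auto intro!: poly_mapping_eqI)
    from leading_dvd_lookup[OF \<Psi> this[unfolded xs_def ys_def] g[unfolded g_def], of 1 z]
    show False using leading_int[of 0 0 1] by (simp add: z \<sigma>_zero)
  qed
  have tw: "twist q n \<gamma> = [:[:q powi n:]:] * \<gamma>" for n unfolding \<gamma> by (rule twist_t)
  \<comment> \<open>The relation leaves the factor q^n - q, which vanishes only for n = 1; for y the
    factor is 1 - q^(n + 1).\<close>
  have "Poly_Mapping.lookup xs n = 0" if "n \<noteq> 1" for n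
  proof -
    have "([:[:q powi n:]:] - [:[:q:]:]) * (\<gamma> * Poly_Mapping.lookup xs n) = 0"
      using xs[of n] unfolding tw by (simp only: algebra_simps) simp
    moreover have "q powi n \<noteq> q"
    proof
      assume "q powi n = q"
      then have "q powi (n - 1) = 1" using q(1) by (simp add: power_int_diff)
      with power_int_eq_1_imp[OF q(2)] that show False by force
    qed
    ultimately show ?thesis using \<gamma>0 by simp
  qed
  then obtain p where p: "xs = Poly_Mapping.single 1 p" using poly_mapping_eq_singleI by metis
  have "Poly_Mapping.lookup ys n = 0" if "n \<noteq> - 1" for n
  proof -
    have "(1 - [:[:q * q powi n:]:]) * (\<gamma> * Poly_Mapping.lookup ys n)
        = \<gamma> * Poly_Mapping.lookup ys n - [:[:q:]:] * Poly_Mapping.lookup ys n * twist q n \<gamma>"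
      unfolding tw const[symmetric] by (simp only: algebra_simps mult_1_left)
    then have "(1 - [:[:q * q powi n:]:]) * (\<gamma> * Poly_Mapping.lookup ys n) = 0"
      by (simp only: ys[symmetric] diff_self)
    moreover have "q * q powi n \<noteq> 1"
    proof
      assume "q * q powi n = 1"
      then have "q powi (n + 1) = 1" using q(1) by (simp add: power_int_add mult.commute)
      with power_int_eq_1_imp[OF q(2)] that show False by force
    qed
    ultimately show ?thesis using \<gamma>0 by (simp add: one_pCons)
  qed
  then obtain s where s: "ys = Poly_Mapping.single (- 1) s" using poly_mapping_eq_singleI by metis
  have lead1: "leading c d 1 = c" "leading c d (- 1) = d" for c d
    using leading_int[of c d 1] leading_minus_int[of c d 1] by (simp_all add: \<sigma>_zero_exp)
  note lead_\<Psi> = leading_dvd_lookup[OF \<Psi> p[unfolded xs_def] s[unfolded ys_def] g[unfolded g_def]]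
  \<comment> \<open>The element x lies in the range of \<Psi>, so the bound for \<Psi> in degree 1
    forces p to divide 1.\<close>
  have "p dvd 1" using lead_\<Psi>[of 1 z] by (simp add: z lead1)
  then obtain \<pi> where \<pi>: "\<pi> \<noteq> 0" "p = [:[:\<pi>:]:]"
    by (metis is_unit_poly_iff unit_const_polyE)
  obtain z' where z': "\<Psi> z' = Poly_Mapping.single (- 1) \<omega>" using lift[of ?y] by (auto simp: Ny)
  \<comment> \<open>Here s divides \<omega> because y is in the range of \<Psi>, and \<omega>
    divides s because \<Psi> takes values in the image of R(f2). Hence they are associates.\<close>
  have "s dvd \<omega>" using lead_\<Psi>[of "- 1" z'] by (simp add: z' lead1)
  then obtain r' where r': "\<omega> = s * r'" by (rule dvdE)
  have "\<omega> dvd s" using lead[of "- 1" ?y] s by (simp add: lead1 ys_def)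
  then obtain r where r: "s = \<omega> * r" by (rule dvdE)
  have "\<omega> * 1 = \<omega> * (r * r')" using r r' by (simp add: ac_simps)
  then have "1 = r * r'" using \<omega>0 by (simp only: mult_cancel_left simp_thms)
  then have "r dvd 1" by (rule dvdI)
  then obtain \<rho> where \<rho>: "\<rho> \<noteq> 0" "r = [:[:\<rho>:]:]"
    by (metis is_unit_poly_iff unit_const_polyE)
  have "tmul xs ys - tmul ys xs = \<Psi> (free_eval f1 ?h)"
    using ker[OF smith_relator_mem(3)] by (simp add: hom xs_def ys_def)
  also have "\<dots> = Poly_Mapping.single 0 (\<Sum>i\<le>degree f1. [:[:coeff f1 i:]:] * \<gamma> ^ i)"
    by (rule graded_hom_free_eval[OF \<Psi> g[unfolded g_def]])
  finally have "Poly_Mapping.lookup (tmul xs ys - tmul ys xs) 0 = (\<Sum>i\<le>degree f1. [:[:coeff f1 i:]:] * \<gamma> ^ i)"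
    by simp
  then have rel: "p * twist q 1 s - s * twist q (- 1) p = (\<Sum>i\<le>degree f1. [:[:coeff f1 i:]:] * \<gamma> ^ i)"
    by (simp add: p s tmul_single_single lookup_minus del: mult_pCons_left mult_pCons_right)
  have "p * twist q 1 s - s * twist q (- 1) p = [:[:\<pi> * \<rho>:]:] * (twist q 1 \<omega> - \<omega>)"
    unfolding r \<pi> \<rho> \<sigma>_mult \<sigma>_\<iota> const[symmetric] by (simp only: algebra_simps)
  then have cf: "coeff ([:[:\<pi> * \<rho>:]:] * (twist q 1 \<omega> - \<omega>)) n = [:coeff f1 n * \<beta> ^ n:]" for n
    using rel coeff_eval_linear[of f1 \<beta> n] unfolding \<gamma> by simp
  \<comment> \<open>The variable \<Omega> occurs only in the coefficient of index 0, where the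
    difference of \<omega> and its twist is zero.\<close>
  have "coeff f1 n * \<beta> ^ n = (\<pi> * \<rho>) * ((q ^ n - 1) * coeff a2 n)" for n
  proof (cases "n = 0")
    case True
    then show ?thesis using cf[of 0] by (simp add: coeff_twist)
  next
    case False
    then show ?thesis using cf[of n] by (simp add: coeff_twist \<omega>_def coeff_casimir_shift algebra_simps)
  qed
  with \<beta> \<pi> \<rho> show ?thesis by (intro exI[of _ \<beta>] exI[of _ "\<pi> * \<rho>"]) auto
qed

section \<open>The isomorphism criterion\<close>

text \<open>In the skew Laurent ring xy - yx is the twist of \<Omega> + a(h) minus itself, that is
  a(qh) - a(h) = f(h), because \<Omega> is fixed.\<close>

lemma smith_laurent_ideal:
  fixes q :: "'k::field"
  assumes q: "q \<noteq> 0" and f: "f = pcompose a [:0, q:] - a" and z: "z \<in> smith_ideal q f"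
  shows "smith_laurent q a z = 0"
proof -
  interpret twisted_laurent "twist q" "\<lambda>c. [:[:c:]:]" by (rule twisted_laurent_twist[OF q])
  show ?thesis
  proof (rule graded_hom_smith_ideal[OF graded_hom_laurent_eval _ _ _ _ _ _ z])
    show "laurent_eval (smith_coords a) (free_gen smith_gen.X) = Poly_Mapping.single 1 1"
      "laurent_eval (smith_coords a) (free_gen Y) = Poly_Mapping.single (- 1) (casimir_shift a)"
      "laurent_eval (smith_coords a) (free_gen H) = Poly_Mapping.single 0 [:0, [:1:]:]"
      by (simp_all add: laurent_eval_gen gen_degree_def smith_coords_def one_pCons)
    show "twist q 1 [:0, [:1:]:] = [:[:q:]:] * [:0, [:1:]:]"
      "[:0, [:1:]:] = [:[:q:]:] * twist q (- 1) [:0, [:1:]:]"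
      using q by (simp_all add: twist_def pcompose_pCons)
    show "1 * twist q 1 (casimir_shift a) - casimir_shift a * twist q (- 1) 1
      = (\<Sum>i\<le>degree f. [:[:coeff f i:]:] * [:0, [:1:]:] ^ i)"
    proof (rule poly_eqI)
      fix n
      have "coeff f n = q ^ n * coeff a n - coeff a n" by (simp add: f coeff_pcompose_linear)
      then show "coeff (1 * twist q 1 (casimir_shift a) - casimir_shift a * twist q (- 1) 1) n
        = coeff (\<Sum>i\<le>degree f. [:[:coeff f i:]:] * [:0, [:1:]:] ^ i) n"
        unfolding coeff_eval_linear by (simp add: \<sigma>_one coeff_twist coeff_casimir_shift)
    qed
  qed
qed

text \<open>The isomorphism is lifted to the free algebra by choosing representatives. The lift
  \<psi> need not be a homomorphism, but \<open>smith_laurent q a2\<close> is constant on classes,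
  so the composite \<Psi> is one.\<close>

lemma smith_algebra_iso_coeffs:
  fixes q :: "'k::field"
  assumes q: "q \<noteq> 0" "\<forall>n>0. q ^ n \<noteq> 1" and f1: "poly f1 0 = 0" and f2: "f2 = pcompose a2 [:0, q:] - a2"
    and iso: "algebra_iso (smith_algebra q f1) (smith_algebra q f2) \<noteq> {}"
  shows "\<exists>\<beta> \<kappa>. \<beta> \<noteq> 0 \<and> \<kappa> \<noteq> 0 \<and> (\<forall>n. coeff f1 n * \<beta> ^ n = \<kappa> * ((q ^ n - 1) * coeff a2 n))"
proof -
  interpret twisted_laurent "twist q" "\<lambda>c. [:[:c:]:]" by (rule twisted_laurent_twist[OF q(1)])
  note hom = graded_homD[OF graded_hom_laurent_eval[of "smith_coords a2"]]
  obtain \<phi> where \<phi>: "\<phi> \<in> algebra_iso (smith_algebra q f1) (smith_algebra q f2)" using iso by blast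
  then have \<phi>_hom: "\<phi> \<in> ring_hom (smith_algebra q f1) (smith_algebra q f2)"
    and \<phi>_bij: "bij_betw \<phi> (carrier (smith_algebra q f1)) (carrier (smith_algebra q f2))"
    and \<phi>_smult: "\<And>c p. \<phi> (c \<odot>\<^bsub>smith_algebra q f1\<^esub> smith_class q f1 p) = c \<odot>\<^bsub>smith_algebra q f2\<^esub> \<phi> (smith_class q f1 p)"
    by (auto simp: algebra_iso_def ring_iso_def carrier_smith_algebra)
  have image: "\<phi> ` range (smith_class q f1) = range (smith_class q f2)"
    using \<phi>_bij by (simp add: bij_betw_def carrier_smith_algebra)
  then have "\<forall>p. \<exists>r. \<phi> (smith_class q f1 p) = smith_class q f2 r" by blast
  then obtain \<psi> where \<psi>: "\<And>p. \<phi> (smith_class q f1 p) = smith_class q f2 (\<psi> p)" by metis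
  have eval_cong: "smith_laurent q a2 p = smith_laurent q a2 r" if "smith_class q f2 p = smith_class q f2 r" for p r
    using smith_laurent_ideal[OF q(1) f2, of "p - r"] that by (simp add: smith_class_eq_iff hom)
  define \<Psi> where "\<Psi> p = smith_laurent q a2 (\<psi> p)" for p
  have carr: "smith_class q f1 p \<in> carrier (smith_algebra q f1)" for p by (simp add: carrier_smith_algebra)
  have add: "smith_class q f2 (\<psi> (p + r)) = smith_class q f2 (\<psi> p + \<psi> r)" for p r
    using ring_hom_add[OF \<phi>_hom carr carr, of p r] by (simp add: smith_class_add \<psi>)
  have mult: "smith_class q f2 (\<psi> (p * r)) = smith_class q f2 (\<psi> p * \<psi> r)" for p r
    using ring_hom_mult[OF \<phi>_hom carr carr, of p r] by (simp add: smith_class_mult \<psi>)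
  have one: "smith_class q f2 (\<psi> 1) = smith_class q f2 1"
    using ring_hom_one[OF \<phi>_hom] by (simp add: smith_class_one \<psi>)
  \<comment> \<open>A scalar is c times the unit, so linearity and preservation of 1
    suffice.\<close>
  have scal: "smith_class q f2 (\<psi> (Poly_Mapping.single 0 c)) = smith_class q f2 (Poly_Mapping.single 0 c)" for c
    using \<phi>_smult[of c 1] by (simp add: smith_class_smult \<psi> one)
  have "graded_hom \<Psi>" unfolding graded_hom_def \<Psi>_def
    using eval_cong[OF add] eval_cong[OF mult] eval_cong[OF scal] by (simp add: hom)
  moreover have "\<Psi> z = 0" if "z \<in> smith_ideal q f1" for z
  proof -
    have "smith_class q f1 z = smith_class q f1 0" using that by (simp add: smith_class_eq_iff)
    then have "smith_class q f2 (\<psi> z) = smith_class q f2 (\<psi> 0)" by (metis \<psi>)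
    also have "\<dots> = smith_class q f2 0" using scal[of 0] by simp
    finally show ?thesis unfolding \<Psi>_def by (metis eval_cong hom(4))
  qed
  moreover have "range \<Psi> = range (smith_laurent q a2)"
  proof (intro equalityI subsetI)
    fix s assume "s \<in> range (smith_laurent q a2)"
    then obtain w where w: "s = smith_laurent q a2 w" by auto
    have "smith_class q f2 w \<in> \<phi> ` range (smith_class q f1)" unfolding image by simp
    then obtain p where "smith_class q f2 w = smith_class q f2 (\<psi> p)" by (auto simp: \<psi>)
    then have "s = \<Psi> p" unfolding \<Psi>_def w by (rule eval_cong)
    then show "s \<in> range \<Psi>" by simp
  qed (auto simp: \<Psi>_def)
  ultimately show ?thesis by (rule smith_epi_coeffs[OF q f1])
qed

theorem theorem2p3p1:
  fixes q :: "'k::{alg_closed_field, field_char_0}"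
    and f1 f2 a1 a2 :: "'k poly"
  assumes "q \<noteq> 0"
    and "\<forall>n>0. q ^ n \<noteq> 1"
    and "poly f1 0 = 0"
    and "poly f2 0 = 0"
    and "f1 = pcompose a1 [:0, q:] - a1"
    and "f2 = pcompose a2 [:0, q:] - a2"
  shows "algebra_iso (smith_algebra q f1) (smith_algebra q f2) \<noteq> {} \<longleftrightarrow>
    (\<exists>\<alpha> \<beta> \<rho>. \<beta> \<noteq> 0 \<and> \<rho> \<noteq> 0 \<and> a1 = Polynomial.smult \<rho> (pcompose a2 [:0, \<beta>:]) + [:\<alpha>:])"
proof
  have c1: "coeff f1 n = (q ^ n - 1) * coeff a1 n" and c2: "coeff f2 n = (q ^ n - 1) * coeff a2 n" for n
    by (simp_all add: assms(5,6) coeff_pcompose_linear algebra_simps)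
  {
    assume "algebra_iso (smith_algebra q f1) (smith_algebra q f2) \<noteq> {}"
    from smith_algebra_iso_coeffs[OF assms(1,2,3,6) this]
    obtain \<beta> \<kappa> where \<beta>: "\<beta> \<noteq> 0" "\<kappa> \<noteq> 0" and
      eq: "\<And>n. coeff f1 n * \<beta> ^ n = \<kappa> * ((q ^ n - 1) * coeff a2 n)" by blast
    \<comment> \<open>The identity f1(\<beta>h) = \<kappa> f2(h) is solved for f1, which inverts
      \<beta>. The added constant accounts for the coefficient of index 0, where q^0 - 1 = 0 leaves
      a1 undetermined.\<close>
    have "a1 = Polynomial.smult \<kappa> (pcompose a2 [:0, inverse \<beta>:]) + [:coeff a1 0 - \<kappa> * coeff a2 0:]"
    proof (rule poly_eqI)
      fix n
      show "coeff a1 n = coeff (Polynomial.smult \<kappa> (pcompose a2 [:0, inverse \<beta>:]) + [:coeff a1 0 - \<kappa> * coeff a2 0:]) n"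
      proof (cases "n = 0")
        case False
        then have "q ^ n - 1 \<noteq> 0" using assms(2) by simp
        with eq[of n] have "coeff a1 n * \<beta> ^ n = \<kappa> * coeff a2 n"
          by (simp add: c1 mult.assoc mult.left_commute[of \<kappa>])
        then show ?thesis using False \<beta>
          by (auto simp: coeff_pcompose_linear coeff_pCons field_simps split: nat.split)
      qed (simp add: poly_0_coeff_0)
    qed
    with \<beta> show "\<exists>\<alpha> \<beta> \<rho>. \<beta> \<noteq> 0 \<and> \<rho> \<noteq> 0 \<and> a1 = Polynomial.smult \<rho> (pcompose a2 [:0, \<beta>:]) + [:\<alpha>:]"
      by (intro exI[of _ "coeff a1 0 - \<kappa> * coeff a2 0"] exI[of _ "inverse \<beta>"] exI[of _ \<kappa>]) simp
  }
  assume "\<exists>\<alpha> \<beta> \<rho>. \<beta> \<noteq> 0 \<and> \<rho> \<noteq> 0 \<and> a1 = Polynomial.smult \<rho> (pcompose a2 [:0, \<beta>:]) + [:\<alpha>:]"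
  then obtain \<alpha> \<beta> \<rho> where \<beta>: "\<beta> \<noteq> 0" "\<rho> \<noteq> 0" and a1: "a1 = Polynomial.smult \<rho> (pcompose a2 [:0, \<beta>:]) + [:\<alpha>:]"
    by blast
  show "algebra_iso (smith_algebra q f1) (smith_algebra q f2) \<noteq> {}"
  proof (rule smith_algebra_iso_of_scaling)
    fix i
    \<comment> \<open>The substitution in a2 is undone by scaling h with the inverse of \<beta>; at
      i = 0 both sides vanish, so \<alpha> drops out.\<close>
    show "coeff f1 i * inverse \<beta> ^ i = \<rho> * coeff f2 i"
      using \<beta> by (cases i) (auto simp: c1 c2 a1 coeff_pcompose_linear field_simps)
  qed (use \<beta> in auto)
qed

end
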